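(* Let $X$ be a Banach space and let $\rho\colon[0,\infty)\to[0,\infty)$ be a strictly increasing $C^1$ function with $\rho(0)=0$ and $\lim_{t\to\infty}\rho(t)=\infty$. Assume that the evolution family $\{T(t,s)\}_{t\ge s\ge 0}$ on $X$ admits a $\rho$-dichotomy with respect to a family $\{\|\cdot\|_t\}_{t\ge 0}$ of norms on $X$ satisfying $$\|x\|\le\|x\|_t\le Ce^{\varepsilon\rho(t)}\|x\|\quad\text{for } x\in X,\ t\ge 0,$$ for some $C>0$ and $\varepsilon\ge 0$, and such that $t\mapsto\|x\|_t$ is continuous for each $x\in X$. Then for every $a>0$ there exists $\delta_0>0$ such that for every $\delta\in(0,\delta_0)$ the following holds: if $B\colon[0,\infty)\to\mathcal{B}(X)$ is a strongly continuous operator-valued function with $$\|B(t)\|\le\delta e^{-(\varepsilon+a)\rho(t)}\rho'(t),\quad t\ge 0,$$ then the perturbed evolution family $\{U(t,s)\}_{t\ge s\ge 0}$ satisfying $$U(t,s)=T(t,s)+\int_s^t T(t,\tau)B(\tau)U(\tau,s)\,d\tau,\quad t\ge s\ge 0,$$ admits a $\rho$-dichotomy with respect to the family of norms $\|\cdot\|_t$, $t\ge 0$.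
   Context: $\mathcal{B}(X)$ is the algebra of bounded linear operators on the Banach space $(X,\|\cdot\|)$. Operator-valued integrals are understood pointwise (strongly). A family $\{T(t,s)\}_{t\ge s\ge 0}\subset\mathcal{B}(X)$ is an evolution family if $T(t,t)=\mathrm{Id}$ for $t\ge 0$; $T(t,s)T(s,\tau)=T(t,\tau)$ for $t\ge s\ge\tau\ge 0$; and for all $s\ge 0$, $x\in X$ the map $t\mapsto T(t,s)x$ is continuous on $[s,\infty)$ and the map $t\mapsto T(s,t)x$ is continuous on $[0,s]$. $\rho$-dichotomy: an evolution family $\{T(t,s)\}_{t\ge s\ge 0}$ admits a $\rho$-dichotomy with respect to the norms $\|\cdot\|_t$ if there is a family $\{P(t)\}_{t\ge 0}$ of projections on $X$ with $T(t,s)P(s)=P(t)T(t,s)$ for $t\ge s\ge 0$, such that $T(t,s)|_{\operatorname{Ker}P(s)}\colon\operatorname{Ker}P(s)\to\operatorname{Ker}P(t)$ is invertible for all $t\ge s\ge 0$, and there are constants $\lambda,D>0$ such that for all $x\in X$: $\|T(t,s)P(s)x\|_t\le De^{-\lambda(\rho(t)-\rho(s))}\|x\|_s$ for $t\ge s\ge 0$, and $\|T(t,s)(\mathrm{Id}-P(s))x\|_t\le De^{-\lambda(\rho(s)-\rho(t))}\|x\|_s$ for $0\le t\le s$, where for $0\le t\le s$ one sets $T(t,s):=(T(s,t)|_{\operatorname{Ker}P(t)})^{-1}\colon\operatorname{Ker}P(s)\to\operatorname{Ker}P(t)$. *)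

theory Defs
  imports "HOL-Analysis.Analysis"
begin

definition evolution_family :: "(real \<Rightarrow> real \<Rightarrow> 'a::real_normed_vector \<Rightarrow>\<^sub>L 'a) \<Rightarrow> bool" where
  "evolution_family T \<longleftrightarrow>
     (\<forall>t\<ge>0. T t t = id_blinfun) \<and>
     (\<forall>t s r. t \<ge> s \<and> s \<ge> r \<and> r \<ge> 0 \<longrightarrow> T t s o\<^sub>L T s r = T t r) \<and>
     (\<forall>s\<ge>0. \<forall>x. continuous_on {s..} (\<lambda>t. T t s x)) \<and>
     (\<forall>s\<ge>0. \<forall>x. continuous_on {0..s} (\<lambda>t. T s t x))"

definition is_norm :: "('a::real_vector \<Rightarrow> real) \<Rightarrow> bool" where
  "is_norm n \<longleftrightarrow>
     (\<forall>x. n x \<ge> 0) \<and>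
     (\<forall>x. n x = 0 \<longleftrightarrow> x = 0) \<and>
     (\<forall>c x. n (c *\<^sub>R x) = \<bar>c\<bar> * n x) \<and>
     (\<forall>x y. n (x + y) \<le> n x + n y)"

definition kernel :: "('a::real_normed_vector \<Rightarrow>\<^sub>L 'b::real_normed_vector) \<Rightarrow> 'a set" where
  "kernel A = {x. A x = 0}"

text \<open>For \<open>0 \<le> t \<le> s\<close> this is the inverse of the restriction of \<open>T s t\<close> to a map
  \<open>kernel (P t) \<rightarrow> kernel (P s)\<close>. It is meaningful only on \<open>kernel (P s)\<close>, and only
  when that restriction is bijective.\<close>

definition kernel_inverse ::
  "(real \<Rightarrow> real \<Rightarrow> 'a::real_normed_vector \<Rightarrow>\<^sub>L 'a) \<Rightarrow> (real \<Rightarrow> 'a \<Rightarrow>\<^sub>L 'a) \<Rightarrow> real \<Rightarrow> real \<Rightarrow> 'a \<Rightarrow> 'a" where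
  "kernel_inverse T P t s = inv_into (kernel (P t)) (blinfun_apply (T s t))"

definition rho_dichotomy ::
  "(real \<Rightarrow> real) \<Rightarrow> (real \<Rightarrow> 'a::real_normed_vector \<Rightarrow> real) \<Rightarrow> (real \<Rightarrow> real \<Rightarrow> 'a \<Rightarrow>\<^sub>L 'a) \<Rightarrow> bool" where
  "rho_dichotomy \<rho> N T \<longleftrightarrow>
     (\<exists>P :: real \<Rightarrow> 'a \<Rightarrow>\<^sub>L 'a.
        (\<forall>t\<ge>0. P t o\<^sub>L P t = P t) \<and>
        (\<forall>t s. t \<ge> s \<and> s \<ge> 0 \<longrightarrow> T t s o\<^sub>L P s = P t o\<^sub>L T t s) \<and>
        (\<forall>t s. t \<ge> s \<and> s \<ge> 0 \<longrightarrow> bij_betw (T t s) (kernel (P s)) (kernel (P t))) \<and>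
        (\<exists>l D. l > 0 \<and> D > 0 \<and>
           (\<forall>x t s. t \<ge> s \<and> s \<ge> 0 \<longrightarrow>
              N t (T t s (P s x)) \<le> D * exp (- l * (\<rho> t - \<rho> s)) * N s x) \<and>
           (\<forall>x t s. 0 \<le> t \<and> t \<le> s \<longrightarrow>
              N t (kernel_inverse T P t s (x - P s x)) \<le> D * exp (- l * (\<rho> s - \<rho> t)) * N s x)))"

text \<open>The operator-valued integral is understood strongly. If \<open>T\<close> and \<open>U\<close> are evolution
  families on a Banach space and \<open>B\<close> is strongly continuous on \<open>{0..}\<close>, the integrand is
  continuous in \<open>r\<close> on \<open>{s..t}\<close>, so the integral always exists.\<close>

definition perturbed_by ::
  "(real \<Rightarrow> real \<Rightarrow> 'a::real_normed_vector \<Rightarrow>\<^sub>L 'a) \<Rightarrow> (real \<Rightarrow> 'a \<Rightarrow>\<^sub>L 'a) \<Rightarrow> (real \<Rightarrow> real \<Rightarrow> 'a \<Rightarrow>\<^sub>L 'a) \<Rightarrow> bool" where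
  "perturbed_by T B U \<longleftrightarrow>
     (\<forall>t s x. t \<ge> s \<and> s \<ge> 0 \<longrightarrow>
        U t s x = T t s x + integral {s..t} (\<lambda>r. T t r (B r (U r s x))))"

end

theory Submission
  imports Defs
begin

text \<open>
  Measured in the norms \<open>N t\<close>, the perturbation has size \<open>b(t) = C \<delta> e\<^bsup>-a \<rho>(t)\<^esup> \<rho>'(t)\<close>, whose integral over the
  half line is at most \<open>C \<delta> / a\<close>. Consider a function that on \<open>[0, s]\<close> is an orbit of \<open>U\<close> starting in
  \<open>Ker P(0)\<close>, on \<open>[s, R]\<close> an orbit of \<open>U\<close> ending in \<open>Im P(R)\<close>, and that jumps by \<open>x\<close> at \<open>s\<close>. It satisfies
  an integral equation with the Green function of the dichotomy of \<open>T\<close>, and the weighted supremum with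
  weight \<open>e\<^bsup>\<lambda> |\<rho>(t) - \<rho>(s)|\<^esup>\<close> turns this into an a priori bound by a multiple of \<open>\<parallel>x\<parallel>\<^sub>s\<close>, without loss in \<open>\<lambda>\<close>.
  Such functions exist for every \<open>x\<close> by a continuation argument in \<open>R\<close>, and the bound lets \<open>R \<rightarrow> \<infinity>\<close>. This
  splits \<open>x\<close> into a vector with decaying \<open>U\<close>-orbit and a vector in \<open>U(s,0) Ker P(0)\<close>, and the resulting
  projections form the dichotomy of \<open>U\<close>.
\<close>

section \<open>Norms, norm estimates of integrals and strong continuity\<close>

lemma is_normD:
  assumes "is_norm n"
  shows is_norm_nonneg: "0 \<le> n x"
    and is_norm_zero: "n 0 = 0"
    and is_norm_scaleR: "n (c *\<^sub>R x) = \<bar>c\<bar> * n x"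
    and is_norm_triangle: "n (x + y) \<le> n x + n y"
    and is_norm_minus: "n (- x) = n x"
    and is_norm_diff: "n (x - y) \<le> n x + n y"
proof -
  show "0 \<le> n x" "n 0 = 0" "n (c *\<^sub>R x) = \<bar>c\<bar> * n x"
    and tri: "n (x + y) \<le> n x + n y" for x y c
    using assms unfolding is_norm_def by auto
  have "n ((-1) *\<^sub>R x) = \<bar>-1\<bar> * n x" for x
    using assms unfolding is_norm_def by blast
  then show m: "n (- x) = n x" for x by simp
  show "n (x - y) \<le> n x + n y"
    using tri[of x "- y"] m[of y] by simp
qed

lemma is_norm_sum:
  assumes "is_norm n" "finite A"
  shows "n (sum f A) \<le> (\<Sum>a\<in>A. n (f a))"
  using assms(2)
proof (induction A rule: finite_induct)
  case empty
  then show ?case using assms(1) by (simp add: is_norm_zero)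
next
  case (insert a A)
  then show ?case using is_norm_triangle[OF assms(1), of "f a" "sum f A"] by simp
qed

text \<open>The estimate holds for Riemann sums over a common fine division, by the triangle
  inequality for \<open>n\<close>. Since \<open>n\<close> is dominated by a multiple of
  \<open>norm\<close>, it survives the limit. Integrals taken in the norm topology can thus be
  measured in \<open>N t\<close>.\<close>

lemma is_norm_integral_le:
  fixes g :: "real \<Rightarrow> 'a::real_normed_vector"
  assumes n: "is_norm n" and c: "\<And>x. n x \<le> c * norm x"
    and g: "(g has_integral i) {a..b}" and h: "(h has_integral j) {a..b}"
    and le: "\<And>x. x \<in> {a..b} \<Longrightarrow> n (g x) \<le> h x"
  shows "n i \<le> j"
proof (rule field_le_epsilon)
  fix e :: real
  assume "e > 0"
  define d where "d = e / (2 * (\<bar>c\<bar> + 1))"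
  have d: "d > 0" "\<bar>c\<bar> * d \<le> e / 2"
    using \<open>e > 0\<close> by (simp_all add: d_def field_simps)
  have e2: "e / 2 > 0" using \<open>e > 0\<close> by simp
  obtain \<gamma> where \<gamma>: "gauge \<gamma>"
    "\<And>p. p tagged_division_of cbox a b \<Longrightarrow> \<gamma> fine p \<Longrightarrow>
      norm ((\<Sum>(x, k)\<in>p. measure lborel k *\<^sub>R g x) - i) < d"
    using g[unfolded box_real[symmetric] has_integral] d(1) by metis
  obtain \<delta> where \<delta>: "gauge \<delta>"
    "\<And>p. p tagged_division_of cbox a b \<Longrightarrow> \<delta> fine p \<Longrightarrow>
      norm ((\<Sum>(x, k)\<in>p. measure lborel k *\<^sub>R h x) - j) < e / 2"
    using h[unfolded box_real[symmetric] has_integral] e2 by metis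
  obtain p where p: "p tagged_division_of cbox a b" "(\<lambda>x. \<gamma> x \<inter> \<delta> x) fine p"
    using fine_division_exists[OF gauge_Int[OF \<gamma>(1) \<delta>(1)]] by blast
  have fine: "\<gamma> fine p" "\<delta> fine p"
    using p(2) by (auto simp: fine_def)
  define G where "G = (\<Sum>(x, k)\<in>p. measure lborel k *\<^sub>R g x)"
  define H where "H = (\<Sum>(x, k)\<in>p. measure lborel k *\<^sub>R h x)"
  have "n G \<le> (\<Sum>z\<in>p. n (case z of (x, k) \<Rightarrow> measure lborel k *\<^sub>R g x))"
    unfolding G_def using is_norm_sum[OF n] p(1) by blast
  also have "\<dots> \<le> H"
    unfolding H_def
  proof (rule sum_mono, safe)
    fix x k assume "(x, k) \<in> p"
    then have "x \<in> {a..b}"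
      using tag_in_interval[OF p(1)] by auto
    then show "n (measure lborel k *\<^sub>R g x) \<le> measure lborel k *\<^sub>R h x"
      using le by (simp add: is_norm_scaleR[OF n] mult_left_mono)
  qed
  finally have "n G \<le> H" .
  moreover have "n (i - G) \<le> e / 2"
  proof -
    have "n (i - G) \<le> c * norm (i - G)" by (rule c)
    also have "\<dots> \<le> \<bar>c\<bar> * norm (G - i)"
      by (simp add: mult_right_mono norm_minus_commute)
    also have "\<dots> \<le> \<bar>c\<bar> * d"
      using \<gamma>(2)[OF p(1) fine(1)] by (intro mult_left_mono) (auto simp: G_def)
    finally show ?thesis using d(2) by simp
  qed
  moreover have "H \<le> j + e / 2"
    using \<delta>(2)[OF p(1) fine(2), folded H_def] by (simp only: real_norm_def)
  moreover have "n i \<le> n (i - G) + n G"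
    using is_norm_triangle[OF n, of "i - G" G] by simp
  ultimately show "n i \<le> j + e" by simp
qed

text \<open>Splitting \<open>A t (f t)\<close> into \<open>A t (f t - f s) + A t (f s)\<close>
  leaves one term controlled by the uniform bound \<open>M\<close> and one by strong
  continuity.\<close>

lemma continuous_on_blinfun_apply_strong:
  fixes A :: "'b::metric_space \<Rightarrow> 'a::real_normed_vector \<Rightarrow>\<^sub>L 'c::real_normed_vector"
  assumes A: "\<And>x. continuous_on S (\<lambda>t. A t x)"
    and M: "\<And>t. t \<in> S \<Longrightarrow> norm (A t) \<le> M"
    and f: "continuous_on S f"
  shows "continuous_on S (\<lambda>t. A t (f t))"
  unfolding continuous_on_def
proof
  fix s assume s: "s \<in> S"
  have "((\<lambda>t. A t (f t - f s)) \<longlongrightarrow> 0) (at s within S)"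
  proof (rule Lim_null_comparison)
    show "\<forall>\<^sub>F t in at s within S. norm (A t (f t - f s)) \<le> M * norm (f t - f s)"
      unfolding eventually_at_filter
      by (rule always_eventually)
        (auto intro!: order_trans[OF norm_blinfun] mult_right_mono M)
    have "((\<lambda>t. M * norm (f t - f s)) \<longlongrightarrow> M * norm (f s - f s)) (at s within S)"
      using f s unfolding continuous_on_def by (intro tendsto_intros) auto
    then show "((\<lambda>t. M * norm (f t - f s)) \<longlongrightarrow> 0) (at s within S)" by simp
  qed
  moreover have "((\<lambda>t. A t (f s)) \<longlongrightarrow> A s (f s)) (at s within S)"
    using A s unfolding continuous_on_def by blast
  ultimately have "((\<lambda>t. A t (f t - f s) + A t (f s)) \<longlongrightarrow> 0 + A s (f s)) (at s within S)"
    by (rule tendsto_add)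
  then show "((\<lambda>t. A t (f t)) \<longlongrightarrow> A s (f s)) (at s within S)"
    by (simp add: blinfun.diff_right)
qed

text \<open>The supremum is itself an admissible \<open>M\<close>, so
  \<open>Sup F \<le> a + q * Sup F\<close>, which can be solved for \<open>Sup F\<close>.\<close>

lemma bounded_by_contraction:
  fixes F :: "real set"
  assumes "bdd_above F" "q < 1"
    and step: "\<And>M. (\<And>z. z \<in> F \<Longrightarrow> z \<le> M) \<Longrightarrow> (\<And>z. z \<in> F \<Longrightarrow> z \<le> a + q * M)"
    and "z \<in> F"
  shows "z \<le> a / (1 - q)"
proof -
  have "Sup F \<le> a + q * Sup F"
    using assms(4) by (intro cSup_least step) (auto intro: cSup_upper assms(1))
  then have "Sup F \<le> a / (1 - q)"
    using assms(2) by (simp add: field_simps)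
  then show ?thesis
    using cSup_upper[OF assms(4,1)] by simp
qed

section \<open>Perturbed surjections and bounded projections\<close>

text \<open>With a right inverse \<open>g\<close> of \<open>A'\<close> on \<open>K\<close>, solving
  \<open>A (g z) = k\<close> becomes the fixed point equation \<open>z = k - (A - A') (g z)\<close>,
  a contraction on \<open>K\<close>. The error is measured against \<open>A'\<close> itself, so no
  bound on \<open>g\<close> enters.\<close>

lemma surj_on_perturbation:
  fixes A A' :: "'a::banach \<Rightarrow>\<^sub>L 'a"
  assumes K: "closed K" "subspace K"
    and A: "\<And>w. w \<in> K \<Longrightarrow> A w \<in> K" and A': "blinfun_apply A' ` K = K"
    and q: "0 \<le> q" "q < 1"
    and le: "\<And>w. w \<in> K \<Longrightarrow> norm (A w - A' w) \<le> q * norm (A' w)"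
  shows "blinfun_apply A ` K = K"
proof
  show "blinfun_apply A ` K \<subseteq> K" using A by auto
  show "K \<subseteq> blinfun_apply A ` K"
  proof
    fix k assume k: "k \<in> K"
    define g where "g = inv_into K (blinfun_apply A')"
    have g: "g z \<in> K" "A' (g z) = z" if "z \<in> K" for z
      using that A' inv_into_into[of z "blinfun_apply A'" K] f_inv_into_f[of z "blinfun_apply A'" K]
      by (auto simp: g_def)
    define f where "f z = k - (A (g z) - A' (g z))" for z
    have "\<exists>!z\<in>K. f z = z"
    proof (rule Banach_fix)
      show "complete K" using K(1) complete_eq_closed by blast
      show "K \<noteq> {}" using k by auto
      show "f ` K \<subseteq> K"
        unfolding f_def using k A g K(2) by (auto intro!: subspace_diff)
      fix x y assume xy: "x \<in> K" "y \<in> K"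
      have "f y - f x = A (g x - g y) - A' (g x - g y)"
        by (simp add: f_def blinfun.diff_right)
      moreover have "norm (A (g x - g y) - A' (g x - g y)) \<le> q * norm (A' (g x - g y))"
        using xy g K(2) by (intro le subspace_diff)
      moreover have "A' (g x - g y) = x - y"
        using xy g by (simp add: blinfun.diff_right)
      ultimately show "dist (f x) (f y) \<le> q * dist x y"
        by (metis dist_norm norm_minus_commute)
    qed (use q in auto)
    then obtain z where z: "z \<in> K" "f z = z" by blast
    then have "A (g z) = k" using g(2)[OF z(1)] by (simp add: f_def)
    then show "k \<in> blinfun_apply A ` K" using g(1)[OF z(1)] by blast
  qed
qed

text \<open>Trivial intersection makes the decomposition unique, hence linear in \<open>x\<close>;
  the constant \<open>c\<close> makes it bounded.\<close>

lemma bounded_projection_exists: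
  fixes S E :: "'a::real_normed_vector set"
  assumes S: "subspace S" and E: "subspace E" and 0: "S \<inter> E = {0}"
    and ex: "\<And>x. \<exists>v\<in>S. x - v \<in> E \<and> norm v \<le> c * norm x"
  shows "\<exists>Q :: 'a \<Rightarrow>\<^sub>L 'a. \<forall>x. Q x \<in> S \<and> x - Q x \<in> E"
proof -
  obtain f where f: "\<And>x. f x \<in> S" "\<And>x. x - f x \<in> E" "\<And>x. norm (f x) \<le> c * norm x"
    using ex by metis
  have uniq: "v = f x" if "v \<in> S" "x - v \<in> E" for v x
  proof -
    have "v - f x \<in> S" using that(1) f(1) S by (intro subspace_diff)
    moreover have "(x - f x) - (x - v) \<in> E" by (rule subspace_diff[OF E f(2) that(2)])
    then have "v - f x \<in> E" by simp
    ultimately have "v - f x \<in> S \<inter> E" by blast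
    then show ?thesis using 0 by simp
  qed
  have "bounded_linear f"
  proof (rule bounded_linear_intro)
    fix x y r
    have "(x - f x) + (y - f y) \<in> E" using f E by (intro subspace_add)
    then show "f (x + y) = f x + f y"
      using f S by (intro uniq[symmetric] subspace_add) (auto simp: algebra_simps)
    have "r *\<^sub>R (x - f x) \<in> E" using f E by (intro subspace_scale)
    then show "f (r *\<^sub>R x) = r *\<^sub>R f x"
      using f S by (intro uniq[symmetric] subspace_scale) (auto simp: algebra_simps)
    show "norm (f x) \<le> norm x * c" using f(3)[of x] by (simp add: mult.commute)
  qed
  then show ?thesis
    using f by (intro exI[of _ "Blinfun f"]) (simp add: bounded_linear_Blinfun_apply)
qed

lemma subspace_kernel: "subspace (kernel A)"
  by (auto simp: subspace_def kernel_def blinfun.add_right blinfun.scaleR_right)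

lemma closed_kernel: "closed (kernel A)"
  unfolding kernel_def by (intro closed_Collect_eq continuous_intros)

lemma evolution_family_comp:
  assumes "evolution_family W" "0 \<le> r" "r \<le> s" "s \<le> t"
  shows "W t s (W s r x) = W t r x"
proof -
  have "W t s o\<^sub>L W s r = W t r"
    using assms by (simp add: evolution_family_def)
  then show ?thesis by (metis blinfun_apply_blinfun_compose)
qed

text \<open>\<open>V t s\<close> is the backward flow \<open>T(t,s)(Id - P(s))\<close> for \<open>t \<le> s\<close>, a bounded operator on the
  whole space; \<open>b\<close> is the size of the perturbation measured in the norms \<open>N t\<close>, with
  antiderivative \<open>H\<close>.\<close>

locale perturbed_dichotomy =
  fixes T U V :: "real \<Rightarrow> real \<Rightarrow> 'a::banach \<Rightarrow>\<^sub>L 'a"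
    and P B :: "real \<Rightarrow> 'a \<Rightarrow>\<^sub>L 'a"
    and N :: "real \<Rightarrow> 'a \<Rightarrow> real"
    and \<rho> c b H :: "real \<Rightarrow> real"
    and l D q :: real
  assumes T: "evolution_family T" and U: "evolution_family U"
    and norm_N: "0 \<le> t \<Longrightarrow> is_norm (N t)"
    and norm_le_N: "0 \<le> t \<Longrightarrow> norm x \<le> N t x"
    and N_le: "0 \<le> t \<Longrightarrow> N t x \<le> c t * norm x"
    and c_mono: "0 \<le> s \<Longrightarrow> s \<le> t \<Longrightarrow> c s \<le> c t"
    and \<rho>_0: "\<rho> 0 = 0"
    and \<rho>_mono: "0 \<le> s \<Longrightarrow> s \<le> t \<Longrightarrow> \<rho> s \<le> \<rho> t"
    and \<rho>_top: "filterlim \<rho> at_top at_top"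
    and l_pos: "0 < l" and D_pos: "0 < D"
    and P_idem: "0 \<le> t \<Longrightarrow> P t (P t x) = P t x"
    and T_P: "0 \<le> s \<Longrightarrow> s \<le> t \<Longrightarrow> T t s (P s x) = P t (T t s x)"
    and P_V: "0 \<le> t \<Longrightarrow> t \<le> s \<Longrightarrow> P t (V t s x) = 0"
    and T_V: "0 \<le> t \<Longrightarrow> t \<le> s \<Longrightarrow> T s t (V t s x) = x - P s x"
    and V_T: "0 \<le> t \<Longrightarrow> t \<le> s \<Longrightarrow> V t s (T s t x) = x - P t x"
    and T_P_le: "0 \<le> s \<Longrightarrow> s \<le> t \<Longrightarrow>
      N t (T t s (P s x)) \<le> D * exp (- l * (\<rho> t - \<rho> s)) * N s x"
    and V_le: "0 \<le> t \<Longrightarrow> t \<le> s \<Longrightarrow>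
      N t (V t s x) \<le> D * exp (- l * (\<rho> s - \<rho> t)) * N s x"
    and B_cont: "continuous_on {0..} (\<lambda>t. B t x)"
    and B_le: "0 \<le> t \<Longrightarrow> N t (B t x) \<le> b t * N t x"
    and b_cont: "continuous_on {0..} b" and b_nonneg: "0 \<le> t \<Longrightarrow> 0 \<le> b t"
    and H: "0 \<le> t \<Longrightarrow> (H has_real_derivative b t) (at t within {0..})"
    and H_le: "0 \<le> t \<Longrightarrow> D * (H t - H 0) \<le> q" and q_less: "q < 1"
    and perturbed: "perturbed_by T B U"
begin

section \<open>Algebra of the forward and backward flows\<close>

lemma T_id: "0 \<le> t \<Longrightarrow> T t t x = x" and U_id: "0 \<le> t \<Longrightarrow> U t t x = x"
  using T U by (auto simp: evolution_family_def)

lemmas T_comp = evolution_family_comp[OF T]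
  and U_comp = evolution_family_comp[OF U]

lemma U_eq: "0 \<le> s \<Longrightarrow> s \<le> t \<Longrightarrow>
    U t s x = T t s x + integral {s..t} (\<lambda>r. T t r (B r (U r s x)))"
  using perturbed unfolding perturbed_by_def by blast

lemma V_P:
  assumes "0 \<le> t" "t \<le> s"
  shows "V t s (P s x) = 0"
proof -
  have "T s t (V t s (P s x)) = 0"
    using assms T_V P_idem by simp
  then show ?thesis
    using V_T[OF assms, of "V t s (P s x)"] P_V[OF assms, of "P s x"] by simp
qed

text \<open>Both sides lie in \<open>kernel (P t)\<close> and have the same image under
  \<open>T r t\<close>, which \<open>V t r\<close> inverts there.\<close>

lemma V_comp:
  assumes "0 \<le> t" "t \<le> s" "s \<le> r"
  shows "V t s (V s r x) = V t r x"
proof -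
  have "T r t (V t s (V s r x)) = T r s (T s t (V t s (V s r x)))"
    using assms by (simp add: T_comp)
  also have "\<dots> = x - P r x"
    using assms by (simp add: T_V P_V blinfun.diff_right)
  finally have "V t r (T r t (V t s (V s r x))) = V t r x"
    using assms by (simp add: blinfun.diff_right V_P)
  then show ?thesis using assms by (simp add: V_T P_V)
qed

text \<open>The round trip from \<open>r\<close> to \<open>s\<close> and back only removes the
  \<open>P r\<close> component, which \<open>V t r\<close> kills anyway.\<close>

lemma V_T_comp:
  assumes "0 \<le> t" "t \<le> r" "r \<le> s"
  shows "V t s (T s r x) = V t r x"
proof -
  have "V t s (T s r x) = V t r (V r s (T s r x))"
    using assms by (simp add: V_comp)
  then show ?thesis
    using assms by (simp add: V_T blinfun.diff_right V_P)
qed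

section \<open>Bounds on compact time intervals and continuity of the integrand\<close>

lemma N_nonneg: "0 \<le> t \<Longrightarrow> 0 \<le> N t x"
  by (rule is_norm_nonneg[OF norm_N])

lemma N_le_uniform:
  assumes "0 \<le> r" "r \<le> t"
  shows "N r x \<le> \<bar>c t\<bar> * norm x"
proof -
  have "c r * norm x \<le> \<bar>c t\<bar> * norm x"
    using c_mono[OF assms] by (intro mult_right_mono) auto
  then show ?thesis using N_le[OF assms(1), of x] by linarith
qed

lemma decay_le_1: "0 \<le> s \<Longrightarrow> s \<le> t \<Longrightarrow> exp (- l * (\<rho> t - \<rho> s)) \<le> 1"
  using \<rho>_mono l_pos by simp

lemma V_norm_le:
  assumes "0 \<le> t" "t \<le> s"
  shows "norm (V t s x) \<le> D * N s x"
proof -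
  have "norm (V t s x) \<le> N t (V t s x)"
    using assms norm_le_N by blast
  also have "\<dots> \<le> D * exp (- l * (\<rho> s - \<rho> t)) * N s x"
    using assms V_le by blast
  also have "\<dots> \<le> D * 1 * N s x"
    using assms decay_le_1 D_pos N_nonneg
    by (intro mult_right_mono mult_left_mono) auto
  finally show ?thesis by simp
qed

text \<open>No uniform boundedness principle is needed: the dichotomy estimates alone bound
  \<open>T t r = T t r P r + T t 0 V 0 r\<close>.\<close>

lemma T_bounded:
  assumes "0 \<le> t"
  shows "\<exists>M. \<forall>r\<in>{0..t}. norm (T t r) \<le> M"
proof -
  define M where "M = (D + norm (T t 0) * D) * \<bar>c t\<bar>"
  have "norm (T t r) \<le> M" if r: "r \<in> {0..t}" for r
  proof (rule norm_blinfun_bound)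
    show "0 \<le> M" using D_pos by (simp add: M_def)
    fix x
    have Nr: "N r x \<le> \<bar>c t\<bar> * norm x"
      using r by (intro N_le_uniform) auto
    have "T t 0 (V 0 r x) = T t r (T r 0 (V 0 r x))"
      using r by (simp add: T_comp)
    then have "T t r x = T t r (P r x) + T t 0 (V 0 r x)"
      using r by (simp add: T_V blinfun.diff_right)
    then have "norm (T t r x) \<le> norm (T t r (P r x)) + norm (T t 0 (V 0 r x))"
      by (simp only: norm_triangle_ineq)
    moreover have "norm (T t r (P r x)) \<le> D * N r x"
    proof -
      have "norm (T t r (P r x)) \<le> N t (T t r (P r x))"
        using assms norm_le_N by blast
      also have "\<dots> \<le> D * exp (- l * (\<rho> t - \<rho> r)) * N r x"
        using r by (intro T_P_le) auto
      also have "\<dots> \<le> D * 1 * N r x"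
        using r decay_le_1 D_pos N_nonneg by (intro mult_right_mono mult_left_mono) auto
      finally show ?thesis by simp
    qed
    moreover have "norm (T t 0 (V 0 r x)) \<le> norm (T t 0) * (D * N r x)"
      using r by (intro order_trans[OF norm_blinfun] mult_left_mono V_norm_le) auto
    ultimately have "norm (T t r x) \<le> (D + norm (T t 0) * D) * N r x"
      by (simp add: algebra_simps)
    also have "\<dots> \<le> (D + norm (T t 0) * D) * (\<bar>c t\<bar> * norm x)"
      using Nr D_pos by (intro mult_left_mono) auto
    finally show "norm (T t r x) \<le> M * norm x" by (simp add: M_def mult.assoc)
  qed
  then show ?thesis by blast
qed

lemma B_bounded:
  assumes "0 \<le> t"
  shows "\<exists>M. \<forall>r\<in>{0..t}. norm (B r) \<le> M"
proof -
  have "bounded (b ` {0..t})"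
    by (intro compact_imp_bounded compact_continuous_image continuous_on_subset[OF b_cont]) auto
  then obtain m where "\<forall>y\<in>b ` {0..t}. norm y \<le> m"
    by (auto simp only: bounded_iff)
  then have m: "b r \<le> m" if "r \<in> {0..t}" for r
    using that by (auto dest!: bspec)
  have "norm (B r) \<le> \<bar>m\<bar> * \<bar>c t\<bar>" if r: "r \<in> {0..t}" for r
  proof (rule norm_blinfun_bound)
    fix x
    have Nr: "N r x \<le> \<bar>c t\<bar> * norm x"
      using r by (intro N_le_uniform) auto
    have "norm (B r x) \<le> N r (B r x)"
      using r norm_le_N by simp
    also have "\<dots> \<le> b r * N r x"
      using r B_le by simp
    also have "\<dots> \<le> \<bar>m\<bar> * (\<bar>c t\<bar> * norm x)"
      using Nr m[OF r] r b_nonneg[of r] N_nonneg[of r x] by (intro mult_mono) auto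
    finally show "norm (B r x) \<le> \<bar>m\<bar> * \<bar>c t\<bar> * norm x" by simp
  qed simp
  then show ?thesis by blast
qed

text \<open>The bounds on \<open>B r\<close> and \<open>T t r\<close> upgrade strong continuity to
  continuity along moving arguments, first for \<open>B\<close>, then for \<open>T\<close>.\<close>

lemma integrand_continuous:
  assumes "0 \<le> s" "s \<le> t"
  shows "continuous_on {s..t} (\<lambda>r. T t r (B r (U r s z)))"
proof -
  obtain M where M: "\<And>r. r \<in> {0..t} \<Longrightarrow> norm (T t r) \<le> M"
    using T_bounded[of t] assms by (metis order_trans)
  obtain M' where M': "\<And>r. r \<in> {0..t} \<Longrightarrow> norm (B r) \<le> M'"
    using B_bounded[of t] assms by (metis order_trans)
  have Tc: "continuous_on {0..t} (\<lambda>r. T t r x)" for x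
    using T assms by (simp add: evolution_family_def)
  have Uc: "continuous_on {s..} (\<lambda>r. U r s z)"
    using U assms by (simp add: evolution_family_def)
  have "continuous_on {s..t} (\<lambda>r. B r (U r s z))"
  proof (rule continuous_on_blinfun_apply_strong)
    show "continuous_on {s..t} (\<lambda>r. B r x)" for x
      by (rule continuous_on_subset[OF B_cont]) (use assms in auto)
    show "continuous_on {s..t} (\<lambda>r. U r s z)"
      by (rule continuous_on_subset[OF Uc]) auto
    show "norm (B r) \<le> M'" if "r \<in> {s..t}" for r
      using that assms by (intro M') auto
  qed
  then show ?thesis
  proof (rule continuous_on_blinfun_apply_strong[rotated 2])
    show "continuous_on {s..t} (\<lambda>r. T t r x)" for x
      by (rule continuous_on_subset[OF Tc]) (use assms in auto)
    show "norm (T t r) \<le> M" if "r \<in> {s..t}" for r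
      using that assms by (intro M) auto
  qed
qed

section \<open>Variation of constants along the stable and the unstable direction\<close>

lemma apply_U_eq:
  fixes A :: "'a \<Rightarrow>\<^sub>L 'a"
  assumes "0 \<le> s" "s \<le> t"
  shows "A (U t s z) = A (T t s z) + integral {s..t} (\<lambda>r. A (T t r (B r (U r s z))))"
proof -
  have "integral {s..t} (blinfun_apply A \<circ> (\<lambda>r. T t r (B r (U r s z)))) =
      A (integral {s..t} (\<lambda>r. T t r (B r (U r s z))))"
    by (intro integral_linear blinfun.bounded_linear_right integrable_continuous_real
        integrand_continuous assms)
  then show ?thesis
    by (subst U_eq[OF assms]) (simp only: blinfun.add_right o_def)
qed

text \<open>Follows by commuting \<open>P\<close> through \<open>T\<close> in the perturbation
  equation. The separate end time \<open>t'\<close> allows one piece of an orbit to be evaluated at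
  a later time, across the jump.\<close>

lemma integral_P:
  assumes "0 \<le> s" "s \<le> t" "t \<le> t'"
  shows "T t' t (P t (U t s z)) = T t' s (P s z) +
    integral {s..t} (\<lambda>r. T t' r (P r (B r (U r s z))))"
proof -
  have "(T t' t o\<^sub>L P t) (U t s z) = (T t' t o\<^sub>L P t) (T t s z) +
      integral {s..t} (\<lambda>r. (T t' t o\<^sub>L P t) (T t r (B r (U r s z))))"
    using assms by (intro apply_U_eq)
  also have "integral {s..t} (\<lambda>r. (T t' t o\<^sub>L P t) (T t r (B r (U r s z)))) =
      integral {s..t} (\<lambda>r. T t' r (P r (B r (U r s z))))"
    using assms by (intro integral_cong) (simp add: T_P[symmetric] T_comp)
  finally show ?thesis
    using assms by (simp add: T_P[symmetric] T_comp)
qed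

text \<open>Under \<open>V r t\<close> each \<open>T t \<tau>\<close> collapses into
  \<open>V r \<tau>\<close>, so unstable components at time \<open>r\<close> are expressed through
  later times.\<close>

lemma integral_V:
  assumes "0 \<le> r" "r \<le> s" "s \<le> t"
  shows "V r t (U t s z) = V r s z + integral {s..t} (\<lambda>\<tau>. V r \<tau> (B \<tau> (U \<tau> s z)))"
proof -
  have "V r t (U t s z) = V r t (T t s z) +
      integral {s..t} (\<lambda>\<tau>. V r t (T t \<tau> (B \<tau> (U \<tau> s z))))"
    using assms by (intro apply_U_eq) auto
  also have "integral {s..t} (\<lambda>\<tau>. V r t (T t \<tau> (B \<tau> (U \<tau> s z)))) =
      integral {s..t} (\<lambda>\<tau>. V r \<tau> (B \<tau> (U \<tau> s z)))"
    using assms by (intro integral_cong) (simp add: V_T_comp)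
  finally show ?thesis using assms by (simp add: V_T_comp)
qed

section \<open>Weighted estimates of the integrals\<close>

lemma b_integral:
  assumes "0 \<le> s" "s \<le> t"
  shows "(b has_integral (H t - H s)) {s..t}"
proof (rule fundamental_theorem_of_calculus[where f = H and f' = b, OF assms(2)])
  fix x assume "x \<in> {s..t}"
  then have "(H has_real_derivative b x) (at x within {s..t})"
    using assms(1) by (intro DERIV_subset[OF H[of x]]) auto
  then show "(H has_vector_derivative b x) (at x within {s..t})"
    by (simp add: has_real_derivative_iff_has_vector_derivative)
qed

lemma H_mono:
  assumes "0 \<le> s" "s \<le> t"
  shows "H s \<le> H t"
  using has_integral_nonneg[OF b_integral[OF assms]] assms(1) b_nonneg by simp

lemma N_integral_le:
  assumes "0 \<le> t" "0 \<le> s" "s \<le> r" "0 \<le> K"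
    and le: "\<And>\<tau>. s \<le> \<tau> \<Longrightarrow> \<tau> \<le> r \<Longrightarrow> N t (F \<tau>) \<le> K * b \<tau>"
  shows "N t (integral {s..r} F) \<le> K * (H r - H s)"
proof (cases "F integrable_on {s..r}")
  case True
  have "((\<lambda>\<tau>. K * b \<tau>) has_integral K * (H r - H s)) {s..r}"
    by (rule has_integral_mult_right[OF b_integral[OF assms(2,3)]])
  then show ?thesis
    by (rule is_norm_integral_le[OF norm_N[OF assms(1)] N_le[OF assms(1)]
          integrable_integral[OF True]])
      (simp add: le)
next
  \<comment> \<open>The integral then has the default value \<open>0\<close>, and the right-hand
    side is nonnegative.\<close>
  case False
  then show ?thesis
    using H_mono[OF assms(2,3)] is_norm_zero[OF norm_N[OF assms(1)]] assms(4)
    by (simp add: not_integrable_integral)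
qed

lemma N_B_le:
  assumes "0 \<le> \<tau>" "N \<tau> y \<le> M * exp E'"
  shows "N \<tau> (B \<tau> y) \<le> b \<tau> * (M * exp E')"
  using order_trans[OF B_le[OF assms(1)] mult_left_mono[OF assms(2) b_nonneg[OF assms(1)]]] .

text \<open>Premise \<open>E\<close> compares exponents: the decay from \<open>\<tau>\<close> to
  \<open>t\<close> combined with the weight at \<open>\<tau>\<close> is absorbed by the weight
  wanted at \<open>t\<close>. Only \<open>b \<tau>\<close> is left to integrate.\<close>

lemma N_T_P_B_le:
  assumes "0 \<le> \<tau>" "\<tau> \<le> t" "0 \<le> M" "N \<tau> y \<le> M * exp E'"
    and E: "- l * (\<rho> t - \<rho> \<tau>) + E' \<le> E"
  shows "N t (T t \<tau> (P \<tau> (B \<tau> y))) \<le> (D * M * exp E) * b \<tau>"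
proof -
  have "N t (T t \<tau> (P \<tau> (B \<tau> y))) \<le> D * exp (- l * (\<rho> t - \<rho> \<tau>)) * N \<tau> (B \<tau> y)"
    using assms by (intro T_P_le)
  also have "\<dots> \<le> D * exp (- l * (\<rho> t - \<rho> \<tau>)) * (b \<tau> * (M * exp E'))"
    using D_pos by (intro mult_left_mono N_B_le assms) auto
  also have "\<dots> = (D * M * b \<tau>) * exp (- l * (\<rho> t - \<rho> \<tau>) + E')"
    by (simp only: exp_add mult_ac)
  also have "\<dots> \<le> (D * M * b \<tau>) * exp E"
    using E D_pos assms b_nonneg by (intro mult_left_mono) auto
  finally show ?thesis by (simp add: mult_ac)
qed

text \<open>The counterpart for the backward flow, where \<open>\<tau>\<close> lies after
  \<open>t\<close>.\<close>

lemma N_V_B_le: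
  assumes "0 \<le> t" "t \<le> \<tau>" "0 \<le> M" "N \<tau> y \<le> M * exp E'"
    and E: "- l * (\<rho> \<tau> - \<rho> t) + E' \<le> E"
  shows "N t (V t \<tau> (B \<tau> y)) \<le> (D * M * exp E) * b \<tau>"
proof -
  have "N t (V t \<tau> (B \<tau> y)) \<le> D * exp (- l * (\<rho> \<tau> - \<rho> t)) * N \<tau> (B \<tau> y)"
    using assms by (intro V_le)
  also have "\<dots> \<le> D * exp (- l * (\<rho> \<tau> - \<rho> t)) * (b \<tau> * (M * exp E'))"
    using D_pos assms by (intro mult_left_mono N_B_le) auto
  also have "\<dots> = (D * M * b \<tau>) * exp (- l * (\<rho> \<tau> - \<rho> t) + E')"
    by (simp only: exp_add mult_ac)
  also have "\<dots> \<le> (D * M * b \<tau>) * exp E"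
    using E D_pos assms b_nonneg[of \<tau>] by (intro mult_left_mono) auto
  finally show ?thesis by (simp add: mult_ac)
qed

section \<open>A priori bound for orbits with one jump\<close>

text \<open>The fixed point of the self-improving bound \<open>M = D + q * M\<close>.\<close>

definition \<kappa> :: real where "\<kappa> = D / (1 - q)"

lemma \<kappa>_pos: "0 < \<kappa>"
  using D_pos q_less by (simp add: \<kappa>_def)

text \<open>A crude bound that serves to make the weighted suprema finite.\<close>

lemma N_orbit_bounded:
  assumes "0 \<le> p" "p \<le> r"
  shows "\<exists>m. \<forall>t\<in>{p..r}. N t (U t p z) \<le> m"
proof -
  have "continuous_on {p..} (\<lambda>t. U t p z)"
    using U assms by (simp add: evolution_family_def)
  then have "continuous_on {p..r} (\<lambda>t. U t p z)"
    by (rule continuous_on_subset) auto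
  then have "bounded ((\<lambda>t. U t p z) ` {p..r})"
    by (intro compact_imp_bounded compact_continuous_image) auto
  then obtain m where m: "\<And>t. t \<in> {p..r} \<Longrightarrow> norm (U t p z) \<le> m"
    by (auto simp only: bounded_iff)
  have "N t (U t p z) \<le> \<bar>c r\<bar> * m" if "t \<in> {p..r}" for t
  proof -
    have "N t (U t p z) \<le> \<bar>c r\<bar> * norm (U t p z)"
      using that assms by (intro N_le_uniform) auto
    also have "\<dots> \<le> \<bar>c r\<bar> * m"
      using m[OF that] by (intro mult_left_mono) auto
    finally show ?thesis .
  qed
  then show ?thesis by blast
qed

text \<open>The function that equals \<open>U t s v\<close> on \<open>[s, R]\<close> and \<open>U t 0 w\<close> on \<open>[0, s]\<close> jumps by
  \<open>x = v - U s 0 w\<close> at \<open>s\<close>. Testing with \<open>P\<close> and \<open>V\<close> expresses it through \<open>x\<close> and integrals of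
  itself, with total weight \<open>q\<close>.\<close>

context
  fixes s R :: real and v w x :: 'a
  assumes s: "0 \<le> s" "s \<le> R" and w: "P 0 w = 0" and v: "P R (U R s v) = U R s v"
    and x: "v = x + U s 0 w"
begin

lemma V_end: "0 \<le> t \<Longrightarrow> t \<le> R \<Longrightarrow> V t R (U R s v) = 0"
  using V_P[of t R "U R s v"] v by simp

lemma P_integral_before:
  assumes "0 \<le> t" "t \<le> s" "t \<le> t'"
  shows "T t' t (P t (U t 0 w)) = integral {0..t} (\<lambda>\<tau>. T t' \<tau> (P \<tau> (B \<tau> (U \<tau> 0 w))))"
  using integral_P[of 0 t t' w] assms w by (simp add: U_id)

text \<open>The stable component is followed forward from time 0 through the jump, the unstable one
  backward from \<open>R\<close>, where it vanishes by \<open>V_end\<close>.\<close>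

lemma forward_eq:
  assumes t: "s \<le> t" "t \<le> R"
  shows "U t s v = T t s (P s x) + integral {0..s} (\<lambda>\<tau>. T t \<tau> (P \<tau> (B \<tau> (U \<tau> 0 w)))) +
    integral {s..t} (\<lambda>\<tau>. T t \<tau> (P \<tau> (B \<tau> (U \<tau> s v)))) -
    integral {t..R} (\<lambda>\<tau>. V t \<tau> (B \<tau> (U \<tau> s v)))"
proof -
  have "V t R (U R t (U t s v)) = V t t (U t s v) +
      integral {t..R} (\<lambda>\<tau>. V t \<tau> (B \<tau> (U \<tau> t (U t s v))))"
    using s t by (intro integral_V) auto
  also have "integral {t..R} (\<lambda>\<tau>. V t \<tau> (B \<tau> (U \<tau> t (U t s v)))) =
      integral {t..R} (\<lambda>\<tau>. V t \<tau> (B \<tau> (U \<tau> s v)))"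
    using s t by (intro integral_cong) (simp add: U_comp)
  also have "V t R (U R t (U t s v)) = 0"
    using s t V_end by (simp add: U_comp)
  also have "V t t (U t s v) = U t s v - P t (U t s v)"
    using V_T[of t t "U t s v"] s t by (simp add: T_id)
  finally have 1: "U t s v = P t (U t s v) - integral {t..R} (\<lambda>\<tau>. V t \<tau> (B \<tau> (U \<tau> s v)))"
    by (simp add: algebra_simps)
  have 2: "P t (U t s v) = T t s (P s v) +
      integral {s..t} (\<lambda>\<tau>. T t \<tau> (P \<tau> (B \<tau> (U \<tau> s v))))"
    using integral_P[of s t t v] s t by (simp add: T_id)
  \<comment> \<open>The jump splits \<open>v\<close> into \<open>x\<close> and
    \<open>U s 0 w\<close>. As \<open>w\<close> is in the kernel of \<open>P 0\<close>, the stable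
    component of \<open>U s 0 w\<close> is made up of the integral alone.\<close>
  have 3: "T t s (P s v) = T t s (P s x) +
      integral {0..s} (\<lambda>\<tau>. T t \<tau> (P \<tau> (B \<tau> (U \<tau> 0 w))))"
    using P_integral_before[of s t] s t by (simp add: x blinfun.add_right)
  show ?thesis
    using 1 unfolding 2 3 .
qed

text \<open>The unstable component at \<open>t\<close> is pulled back from \<open>s\<close>, where
  \<open>U s 0 w = v - x\<close>, and that of \<open>v\<close> is in turn pulled back from
  \<open>R\<close>.\<close>

lemma backward_eq:
  assumes t: "0 \<le> t" "t \<le> s"
  shows "U t 0 w = integral {0..t} (\<lambda>\<tau>. T t \<tau> (P \<tau> (B \<tau> (U \<tau> 0 w)))) - V t s x -
    integral {t..s} (\<lambda>\<tau>. V t \<tau> (B \<tau> (U \<tau> 0 w))) -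
    integral {s..R} (\<lambda>\<tau>. V t \<tau> (B \<tau> (U \<tau> s v)))"
proof -
  have 1: "V t s v = - integral {s..R} (\<lambda>\<tau>. V t \<tau> (B \<tau> (U \<tau> s v)))"
    using integral_V[of t s R v] V_end[of t] s t by (simp add: eq_neg_iff_add_eq_0)
  have "V t s (U s t (U t 0 w)) = V t t (U t 0 w) +
      integral {t..s} (\<lambda>\<tau>. V t \<tau> (B \<tau> (U \<tau> t (U t 0 w))))"
    using s t by (intro integral_V) auto
  also have "integral {t..s} (\<lambda>\<tau>. V t \<tau> (B \<tau> (U \<tau> t (U t 0 w)))) =
      integral {t..s} (\<lambda>\<tau>. V t \<tau> (B \<tau> (U \<tau> 0 w)))"
    using t by (intro integral_cong) (simp add: U_comp)
  also have "V t t (U t 0 w) = U t 0 w - P t (U t 0 w)"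
    using V_T[of t t "U t 0 w"] t by (simp add: T_id)
  also have "V t s (U s t (U t 0 w)) = V t s v - V t s x"
    using t by (simp add: U_comp x blinfun.add_right)
  finally have "U t 0 w = P t (U t 0 w) + V t s v - V t s x -
      integral {t..s} (\<lambda>\<tau>. V t \<tau> (B \<tau> (U \<tau> 0 w)))"
    by (simp add: algebra_simps)
  moreover have "P t (U t 0 w) = integral {0..t} (\<lambda>\<tau>. T t \<tau> (P \<tau> (B \<tau> (U \<tau> 0 w))))"
    using P_integral_before[of t t] t by (simp add: T_id)
  ultimately show ?thesis using 1 by simp
qed

context
  fixes M :: real
  assumes M: "0 \<le> M"
    and M1: "\<And>t. s \<le> t \<Longrightarrow> t \<le> R \<Longrightarrow> N t (U t s v) \<le> M * exp (- l * (\<rho> t - \<rho> s))"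
    and M2: "\<And>t. 0 \<le> t \<Longrightarrow> t \<le> s \<Longrightarrow> N t (U t 0 w) \<le> M * exp (- l * (\<rho> s - \<rho> t))"
begin

text \<open>The three integrals run over adjacent intervals covering \<open>{0..R}\<close>, so their
  bounds add up to the total mass \<open>H R - H 0\<close>, which \<open>H_le\<close> turns into the
  factor \<open>q\<close>.\<close>

lemma forward_step:
  assumes t: "s \<le> t" "t \<le> R"
  shows "N t (U t s v) \<le> (D * N s x + q * M) * exp (- l * (\<rho> t - \<rho> s))"
proof -
  let ?e = "exp (- l * (\<rho> t - \<rho> s))"
  let ?I1 = "integral {0..s} (\<lambda>\<tau>. T t \<tau> (P \<tau> (B \<tau> (U \<tau> 0 w))))"
  let ?I2 = "integral {s..t} (\<lambda>\<tau>. T t \<tau> (P \<tau> (B \<tau> (U \<tau> s v))))"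
  let ?I3 = "integral {t..R} (\<lambda>\<tau>. V t \<tau> (B \<tau> (U \<tau> s v)))"
  have K: "0 \<le> D * M * ?e" using D_pos M by simp
  have ord: "l * \<rho> r \<le> l * \<rho> r'" if "0 \<le> r" "r \<le> r'" for r r'
    using \<rho>_mono[OF that] l_pos by simp
  have n: "is_norm (N t)" using s t by (intro norm_N) auto
  have "N t ?I1 \<le> (D * M * ?e) * (H s - H 0)"
  proof (rule N_integral_le)
    fix \<tau> assume \<tau>: "0 \<le> \<tau>" "\<tau> \<le> s"
    \<comment> \<open>The exponents differ by \<open>2 * l * (\<rho> s - \<rho> \<tau>)\<close> in
      the favourable direction.\<close>
    show "N t (T t \<tau> (P \<tau> (B \<tau> (U \<tau> 0 w)))) \<le> (D * M * ?e) * b \<tau>"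
      by (rule N_T_P_B_le[OF _ _ M M2]) (use \<tau> s t ord[of \<tau> s] in \<open>auto simp: algebra_simps\<close>)
  qed (use s t K in auto)
  moreover have "N t ?I2 \<le> (D * M * ?e) * (H t - H s)"
  proof (rule N_integral_le)
    fix \<tau> assume \<tau>: "s \<le> \<tau>" "\<tau> \<le> t"
    \<comment> \<open>Here decay and weight add up exactly to the weight at \<open>t\<close>, so the
      rate \<open>l\<close> is preserved.\<close>
    show "N t (T t \<tau> (P \<tau> (B \<tau> (U \<tau> s v)))) \<le> (D * M * ?e) * b \<tau>"
      by (rule N_T_P_B_le[OF _ _ M M1]) (use \<tau> s t in \<open>auto simp: algebra_simps\<close>)
  qed (use s t K in auto)
  moreover have "N t ?I3 \<le> (D * M * ?e) * (H R - H t)"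
  proof (rule N_integral_le)
    fix \<tau> assume \<tau>: "t \<le> \<tau>" "\<tau> \<le> R"
    show "N t (V t \<tau> (B \<tau> (U \<tau> s v))) \<le> (D * M * ?e) * b \<tau>"
      by (rule N_V_B_le[OF _ _ M M1]) (use \<tau> s t ord[of t \<tau>] in \<open>auto simp: algebra_simps\<close>)
  qed (use s t K in auto)
  moreover have "N t (T t s (P s x)) \<le> D * ?e * N s x"
    using s t by (intro T_P_le)
  moreover have "N t (U t s v) \<le> N t (T t s (P s x)) + N t ?I1 + N t ?I2 + N t ?I3"
    unfolding forward_eq[OF t]
    using is_norm_diff[OF n, of "T t s (P s x) + ?I1 + ?I2" ?I3]
      is_norm_triangle[OF n, of "T t s (P s x) + ?I1" ?I2]
      is_norm_triangle[OF n, of "T t s (P s x)" ?I1] by linarith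
  ultimately have "N t (U t s v) \<le> D * ?e * N s x + (D * M * ?e) * (H R - H 0)"
    by (simp add: right_diff_distrib)
  also have "(D * M * ?e) * (H R - H 0) = D * (H R - H 0) * (M * ?e)"
    by simp
  also have "\<dots> \<le> q * (M * ?e)"
    using s M by (intro mult_right_mono H_le) auto
  finally show ?thesis by (simp add: algebra_simps)
qed

text \<open>The same bookkeeping with the intervals \<open>{0..t}\<close>, \<open>{t..s}\<close> and
  \<open>{s..R}\<close>; now the exponents match exactly on the middle one.\<close>

lemma backward_step:
  assumes t: "0 \<le> t" "t \<le> s"
  shows "N t (U t 0 w) \<le> (D * N s x + q * M) * exp (- l * (\<rho> s - \<rho> t))"
proof -
  let ?e = "exp (- l * (\<rho> s - \<rho> t))"
  let ?I1 = "integral {0..t} (\<lambda>\<tau>. T t \<tau> (P \<tau> (B \<tau> (U \<tau> 0 w))))"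
  let ?I2 = "integral {t..s} (\<lambda>\<tau>. V t \<tau> (B \<tau> (U \<tau> 0 w)))"
  let ?I3 = "integral {s..R} (\<lambda>\<tau>. V t \<tau> (B \<tau> (U \<tau> s v)))"
  have K: "0 \<le> D * M * ?e" using D_pos M by simp
  have ord: "l * \<rho> r \<le> l * \<rho> r'" if "0 \<le> r" "r \<le> r'" for r r'
    using \<rho>_mono[OF that] l_pos by simp
  have n: "is_norm (N t)" using t by (intro norm_N)
  have "N t ?I1 \<le> (D * M * ?e) * (H t - H 0)"
  proof (rule N_integral_le)
    fix \<tau> assume \<tau>: "0 \<le> \<tau>" "\<tau> \<le> t"
    show "N t (T t \<tau> (P \<tau> (B \<tau> (U \<tau> 0 w)))) \<le> (D * M * ?e) * b \<tau>"
      by (rule N_T_P_B_le[OF _ _ M M2]) (use \<tau> s t ord[of \<tau> t] in \<open>auto simp: algebra_simps\<close>)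
  qed (use s t K in auto)
  moreover have "N t ?I2 \<le> (D * M * ?e) * (H s - H t)"
  proof (rule N_integral_le)
    fix \<tau> assume \<tau>: "t \<le> \<tau>" "\<tau> \<le> s"
    show "N t (V t \<tau> (B \<tau> (U \<tau> 0 w))) \<le> (D * M * ?e) * b \<tau>"
      by (rule N_V_B_le[OF _ _ M M2]) (use \<tau> s t in \<open>auto simp: algebra_simps\<close>)
  qed (use s t K in auto)
  moreover have "N t ?I3 \<le> (D * M * ?e) * (H R - H s)"
  proof (rule N_integral_le)
    fix \<tau> assume \<tau>: "s \<le> \<tau>" "\<tau> \<le> R"
    show "N t (V t \<tau> (B \<tau> (U \<tau> s v))) \<le> (D * M * ?e) * b \<tau>"
      by (rule N_V_B_le[OF _ _ M M1]) (use \<tau> s t ord[of s \<tau>] in \<open>auto simp: algebra_simps\<close>)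
  qed (use s t K in auto)
  moreover have "N t (V t s x) \<le> D * ?e * N s x"
    using t by (intro V_le)
  moreover have "N t (U t 0 w) \<le> N t ?I1 + N t (V t s x) + N t ?I2 + N t ?I3"
    unfolding backward_eq[OF t]
    using is_norm_diff[OF n, of "?I1 - V t s x - ?I2" ?I3]
      is_norm_diff[OF n, of "?I1 - V t s x" ?I2]
      is_norm_diff[OF n, of "?I1" "V t s x"] by linarith
  ultimately have "N t (U t 0 w) \<le> D * ?e * N s x + (D * M * ?e) * (H R - H 0)"
    by (simp add: right_diff_distrib)
  also have "(D * M * ?e) * (H R - H 0) = D * (H R - H 0) * (M * ?e)"
    by simp
  also have "\<dots> \<le> q * (M * ?e)"
    using s M by (intro mult_right_mono H_le) auto
  finally show ?thesis by (simp add: algebra_simps)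
qed

end

text \<open>The two step lemmas improve any weighted bound \<open>M\<close> to
  \<open>D * N s x + q * M\<close>, so the finite supremum over both pieces is at most
  \<open>\<kappa> * N s x\<close>.\<close>

lemma a_priori:
  shows "s \<le> t \<Longrightarrow> t \<le> R \<Longrightarrow> N t (U t s v) \<le> \<kappa> * exp (- l * (\<rho> t - \<rho> s)) * N s x"
    and "0 \<le> t \<Longrightarrow> t \<le> s \<Longrightarrow> N t (U t 0 w) \<le> \<kappa> * exp (- l * (\<rho> s - \<rho> t)) * N s x"
proof -
  define f1 where "f1 t = N t (U t s v) / exp (- l * (\<rho> t - \<rho> s))" for t
  define f2 where "f2 t = N t (U t 0 w) / exp (- l * (\<rho> s - \<rho> t))" for t
  define F where "F = f1 ` {s..R} \<union> f2 ` {0..s}"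
  have f1: "f1 t \<le> z \<longleftrightarrow> N t (U t s v) \<le> z * exp (- l * (\<rho> t - \<rho> s))" for t z
    unfolding f1_def by (subst pos_divide_le_eq) auto
  have f2: "f2 t \<le> z \<longleftrightarrow> N t (U t 0 w) \<le> z * exp (- l * (\<rho> s - \<rho> t))" for t z
    unfolding f2_def by (subst pos_divide_le_eq) auto
  have bdd: "bdd_above F"
  proof -
    obtain m1 where m1: "\<And>t. t \<in> {s..R} \<Longrightarrow> N t (U t s v) \<le> m1"
      using N_orbit_bounded[of s R v] s by blast
    obtain m2 where m2: "\<And>t. t \<in> {0..s} \<Longrightarrow> N t (U t 0 w) \<le> m2"
      using N_orbit_bounded[of 0 s w] s by blast
    define m' where "m' = max \<bar>m1\<bar> \<bar>m2\<bar>"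
    \<comment> \<open>The factor \<open>exp (l * \<rho> R)\<close> outweighs the inverse of every
      weight that occurs on \<open>{0..R}\<close>.\<close>
    define m where "m = m' * exp (l * \<rho> R)"
    have m': "0 \<le> m'" "m1 \<le> m'" "m2 \<le> m'" by (auto simp: m'_def)
    have bnd: "m' \<le> m * exp (- l * (\<rho> r' - \<rho> r))" if "0 \<le> r" "r' \<le> R" "0 \<le> r'" for r r'
    proof -
      have "l * \<rho> r' \<le> l * \<rho> R" "0 \<le> l * \<rho> r"
        using that \<rho>_mono[of r' R] \<rho>_mono[of 0 r] \<rho>_0 l_pos by auto
      then have "1 \<le> exp (l * \<rho> R + - l * (\<rho> r' - \<rho> r))"
        by (simp add: algebra_simps)
      then have "1 \<le> exp (l * \<rho> R) * exp (- l * (\<rho> r' - \<rho> r))"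
        by (simp only: exp_add)
      from mult_left_mono[OF this m'(1)] show ?thesis
        by (simp add: m_def mult.assoc)
    qed
    have "f1 t \<le> m" if "t \<in> {s..R}" for t
      unfolding f1 using m1[OF that] m'(2) bnd[of s t] that s by simp
    moreover have "f2 t \<le> m" if "t \<in> {0..s}" for t
      unfolding f2 using m2[OF that] m'(3) bnd[of t s] that s by simp
    ultimately have "\<And>z. z \<in> F \<Longrightarrow> z \<le> m" by (auto simp: F_def)
    then show ?thesis by (rule bdd_aboveI)
  qed
  have main: "z \<le> D * N s x / (1 - q)" if "z \<in> F" for z
  proof (rule bounded_by_contraction[OF bdd q_less _ that])
    fix M y assume M: "\<And>z. z \<in> F \<Longrightarrow> z \<le> M" and y: "y \<in> F"
    \<comment> \<open>A nonnegative element of \<open>F\<close> forces the upper bound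
      \<open>M\<close> to be nonnegative, as the step lemmas require.\<close>
    have "f1 s \<in> F" using s by (auto simp: F_def)
    moreover have "0 \<le> f1 s" using N_nonneg s by (simp add: f1_def)
    ultimately have M0: "0 \<le> M" using M by fastforce
    have 1: "N t (U t s v) \<le> M * exp (- l * (\<rho> t - \<rho> s))" if "s \<le> t" "t \<le> R" for t
      using M[of "f1 t"] that unfolding f1[symmetric] by (auto simp: F_def)
    have 2: "N t (U t 0 w) \<le> M * exp (- l * (\<rho> s - \<rho> t))" if "0 \<le> t" "t \<le> s" for t
      using M[of "f2 t"] that unfolding f2[symmetric] by (auto simp: F_def)
    have "f1 t \<le> D * N s x + q * M" if "t \<in> {s..R}" for t
      unfolding f1 using that by (intro forward_step[OF M0 1 2]) auto
    moreover have "f2 t \<le> D * N s x + q * M" if "t \<in> {0..s}" for t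
      unfolding f2 using that by (intro backward_step[OF M0 1 2]) auto
    ultimately show "y \<le> D * N s x + q * M"
      using y by (auto simp: F_def)
  qed
  show "N t (U t s v) \<le> \<kappa> * exp (- l * (\<rho> t - \<rho> s)) * N s x" if "s \<le> t" "t \<le> R"
    using main[of "f1 t"] that unfolding f1 by (auto simp: F_def \<kappa>_def field_simps)
  show "N t (U t 0 w) \<le> \<kappa> * exp (- l * (\<rho> s - \<rho> t)) * N s x" if "0 \<le> t" "t \<le> s"
    using main[of "f2 t"] that unfolding f2 by (auto simp: F_def \<kappa>_def field_simps)
qed

end

section \<open>Orbits starting in the kernel of \<open>P 0\<close>\<close>

text \<open>Take \<open>R = s\<close> and \<open>v = 0\<close>: the orbit is cut off at
  \<open>s\<close>, and the jump is \<open>- U s 0 w\<close>.\<close>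

lemma unstable_le:
  assumes w: "P 0 w = 0" and t: "0 \<le> t" "t \<le> s"
  shows "N t (U t 0 w) \<le> \<kappa> * exp (- l * (\<rho> s - \<rho> t)) * N s (U s 0 w)"
  using a_priori(2)[of s s w 0 "- U s 0 w" t] assms is_norm_minus[OF norm_N, of s]
  by simp

text \<open>Take \<open>R = s\<close> and \<open>v = P s (U s 0 w)\<close>: up to sign, the jump is
  the unstable component, which therefore controls the whole orbit.\<close>

lemma unstable_le_complement:
  assumes w: "P 0 w = 0" and t: "0 \<le> t" "t \<le> s"
  shows "N t (U t 0 w) \<le> \<kappa> * exp (- l * (\<rho> s - \<rho> t)) * N s (U s 0 w - P s (U s 0 w))"
proof -
  have "N s (P s (U s 0 w) - U s 0 w) = N s (U s 0 w - P s (U s 0 w))"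
    using is_norm_minus[OF norm_N, of s "U s 0 w - P s (U s 0 w)"] t by simp
  then show ?thesis
    using a_priori(2)[of s s w "P s (U s 0 w)" "P s (U s 0 w) - U s 0 w" t] assms
    by (simp add: U_id P_idem)
qed

section \<open>Continuation of surjectivity in the horizon \<open>R\<close>\<close>

text \<open>Kernel orbits of \<open>T\<close> can be pulled back from \<open>R\<close>, so their
  size at \<open>R\<close> bounds them at all \<open>t \<le> R\<close>.\<close>

lemma N_T_kernel_le:
  assumes k: "P 0 k = 0" and t: "0 \<le> t" "t \<le> R"
  shows "N t (T t 0 k) \<le> D * (\<bar>c R\<bar> * (norm (T R 0) * norm k))"
proof -
  have "T t 0 k = V t R (T R 0 k)"
    using V_T[of t R "T t 0 k"] T_P[of 0 t k] k t by (simp add: T_comp)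
  also have "N t \<dots> \<le> D * exp (- l * (\<rho> R - \<rho> t)) * N R (T R 0 k)"
    using t by (intro V_le)
  also have "\<dots> \<le> D * 1 * (\<bar>c R\<bar> * (norm (T R 0) * norm k))"
  proof (intro mult_mono)
    have "N R (T R 0 k) \<le> \<bar>c R\<bar> * norm (T R 0 k)"
      using t by (intro N_le_uniform) auto
    also have "\<dots> \<le> \<bar>c R\<bar> * (norm (T R 0) * norm k)"
      by (intro mult_left_mono norm_blinfun) auto
    finally show "N R (T R 0 k) \<le> \<bar>c R\<bar> * (norm (T R 0) * norm k)" .
  qed (use t decay_le_1[of t R] D_pos N_nonneg[of R] in auto)
  finally show ?thesis by simp
qed

text \<open>The difference is an integral over \<open>{r..R}\<close> of terms controlled by the
  unstable component at \<open>R\<close>, that is by \<open>V 0 R (U R 0 w)\<close> rather than by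
  \<open>w\<close>. This relative form suits \<open>surj_on_perturbation\<close>, and the constant
  is the same for all \<open>r\<close> and \<open>R\<close> up to \<open>R0\<close>.\<close>

lemma transition_diff_le:
  assumes w: "P 0 w = 0" and R: "0 \<le> r" "r \<le> R" "R \<le> R0"
  shows "norm (V 0 R (U R 0 w) - V 0 r (U r 0 w)) \<le>
    (D * \<kappa> * D * \<bar>c R0\<bar> * norm (T R0 0)) * (H R - H r) * norm (V 0 R (U R 0 w))"
proof -
  \<comment> \<open>The orbit of \<open>k\<close> under \<open>T\<close> reaches at time
    \<open>R\<close> the unstable component of \<open>U R 0 w\<close>.\<close>
  define k where "k = V 0 R (U R 0 w)"
  define M where "M = \<kappa> * (D * (\<bar>c R0\<bar> * (norm (T R0 0) * norm k)))"
  have M: "0 \<le> M" using \<kappa>_pos D_pos by (simp add: M_def)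
  have k: "P 0 k = 0" "U R 0 w - P R (U R 0 w) = T R 0 k"
    using R by (simp_all add: k_def P_V T_V)
  have bnd: "N \<tau> (U \<tau> 0 w) \<le> M * exp 0" if "0 \<le> \<tau>" "\<tau> \<le> R" for \<tau>
  proof -
    have "N \<tau> (U \<tau> 0 w) \<le> \<kappa> * exp (- l * (\<rho> R - \<rho> \<tau>)) * N R (T R 0 k)"
      using unstable_le_complement[OF w that] k(2) by simp
    also have "\<dots> \<le> \<kappa> * 1 * (D * (\<bar>c R0\<bar> * (norm (T R0 0) * norm k)))"
      using R that decay_le_1[of \<tau> R] \<kappa>_pos N_nonneg[of R] k(1)
      by (intro mult_mono N_T_kernel_le) auto
    finally show ?thesis by (simp add: M_def)
  qed
  have "k - V 0 r (U r 0 w) = integral {r..R} (\<lambda>\<tau>. V 0 \<tau> (B \<tau> (U \<tau> r (U r 0 w))))"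
    using integral_V[of 0 r R "U r 0 w"] R by (simp add: k_def U_comp)
  also have "\<dots> = integral {r..R} (\<lambda>\<tau>. V 0 \<tau> (B \<tau> (U \<tau> 0 w)))"
    using R by (intro integral_cong) (simp add: U_comp)
  finally have eq: "k - V 0 r (U r 0 w) = integral {r..R} (\<lambda>\<tau>. V 0 \<tau> (B \<tau> (U \<tau> 0 w)))" .
  have "norm (k - V 0 r (U r 0 w)) \<le> N 0 (k - V 0 r (U r 0 w))"
    by (simp add: norm_le_N)
  also have "\<dots> \<le> (D * M * exp 0) * (H R - H r)"
    unfolding eq
  proof (rule N_integral_le)
    fix \<tau> assume \<tau>: "r \<le> \<tau>" "\<tau> \<le> R"
    show "N 0 (V 0 \<tau> (B \<tau> (U \<tau> 0 w))) \<le> (D * M * exp 0) * b \<tau>"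
      by (rule N_V_B_le[OF _ _ M bnd]) (use \<tau> R \<rho>_mono[of 0 \<tau>] l_pos in auto)
  qed (use R M D_pos in auto)
  finally show ?thesis unfolding k_def[symmetric] by (simp add: M_def mult_ac)
qed

text \<open>Continuation in \<open>R\<close>: on small steps the change of \<open>V 0 R U R 0\<close> on the kernel of \<open>P 0\<close> is
  dominated by the operator itself, so surjectivity is inherited from one step to the next.\<close>

lemma transition_surj:
  assumes R0: "0 \<le> R0"
  shows "blinfun_apply (V 0 R0 o\<^sub>L U R0 0) ` kernel (P 0) = kernel (P 0)"
proof -
  let ?K = "kernel (P 0)"
  let ?A = "\<lambda>R. V 0 R o\<^sub>L U R 0"
  define L where "L = D * \<kappa> * D * \<bar>c R0\<bar> * norm (T R0 0)"
  have L: "0 \<le> L" using D_pos \<kappa>_pos by (simp add: L_def)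
  have "continuous_on {0..} H"
    using H by (intro DERIV_continuous_on) auto
  then have "continuous_on {0..R0} H"
    by (rule continuous_on_subset) auto
  then have "uniformly_continuous_on {0..R0} H"
    by (intro compact_uniformly_continuous) auto
  \<comment> \<open>The tolerance yields \<open>L * (H R - H r) \<le> 1 / 3\<close>; the summand 1
    covers \<open>L = 0\<close>.\<close>
  then obtain d where d: "d > 0"
    "\<And>r r'. r \<in> {0..R0} \<Longrightarrow> r' \<in> {0..R0} \<Longrightarrow> dist r' r < d \<Longrightarrow> dist (H r') (H r) < 1 / (3 * (L + 1))"
    using L unfolding uniformly_continuous_on_def
    by (metis add_nonneg_pos mult_pos_pos zero_less_divide_1_iff zero_less_numeral zero_less_one)
  have step: "blinfun_apply (?A R) ` ?K = ?K"
    if r: "blinfun_apply (?A r) ` ?K = ?K" "0 \<le> r" "r \<le> R" "R \<le> R0" "R - r < d" for r R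
  proof (rule surj_on_perturbation[OF closed_kernel subspace_kernel _ r(1), of _ "1 / 2"])
    show "?A R w \<in> ?K" for w
      using r by (simp add: kernel_def P_V)
    fix w assume "w \<in> ?K"
    then have w: "P 0 w = 0" by (simp add: kernel_def)
    have Hd: "H R - H r \<le> 1 / (3 * (L + 1))"
      using d(2)[of r R] r by (auto simp: dist_real_def)
    have "L * (H R - H r) \<le> L * (1 / (3 * (L + 1)))"
      by (rule mult_left_mono[OF Hd L])
    also have "\<dots> \<le> 1 / 3"
      using L by (simp add: field_simps)
    finally have "L * (H R - H r) * norm (?A R w) \<le> 1 / 3 * norm (?A R w)"
      by (rule mult_right_mono) simp
    then have "norm (?A R w - ?A r w) \<le> 1 / 3 * norm (?A R w)"
      using transition_diff_le[OF w r(2,3,4)] by (simp add: L_def)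
    \<comment> \<open>An error of \<open>1 / 3\<close> relative to the new operator becomes one of
      \<open>1 / 2\<close> relative to the old one.\<close>
    moreover have "norm (?A R w) \<le> norm (?A R w - ?A r w) + norm (?A r w)"
      using norm_triangle_ineq[of "?A R w - ?A r w" "?A r w"] by simp
    ultimately show "norm (?A R w - ?A r w) \<le> 1 / 2 * norm (?A r w)"
      by linarith
  qed auto
  \<comment> \<open>Then \<open>m\<close> equal steps of length \<open>R0 / m < d\<close> lead from
    \<open>0\<close> to \<open>R0\<close>.\<close>
  obtain m :: nat where m: "R0 / d < m"
    using reals_Archimedean2 by blast
  have m0: "0 < real m" using m R0 d(1) by (meson divide_nonneg_pos le_less_trans)
  have "n \<le> m \<Longrightarrow> blinfun_apply (?A (n * (R0 / m))) ` ?K = ?K" for n :: nat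
  proof (induction n)
    case 0
    have "?A 0 w = w" if "w \<in> ?K" for w
      using that V_T[of 0 0 w] by (simp add: U_id T_id kernel_def)
    then show ?case by (simp add: image_def)
  next
    case (Suc n)
    have 1: "blinfun_apply (?A (n * (R0 / m))) ` ?K = ?K"
      using Suc by simp
    have 2: "0 \<le> n * (R0 / m)"
      using R0 by simp
    have 3: "n * (R0 / m) \<le> real (Suc n) * (R0 / m)"
      using R0 by (intro mult_right_mono) auto
    have "real (Suc n) * (R0 / m) \<le> m * (R0 / m)"
      using Suc.prems R0 by (intro mult_right_mono) auto
    then have 4: "real (Suc n) * (R0 / m) \<le> R0"
      using m0 by simp
    have 5: "real (Suc n) * (R0 / m) - n * (R0 / m) < d"
      using m m0 d(1) by (simp add: field_simps)
    show ?case by (rule step[OF 1 2 3 4 5])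
  qed
  from this[of m] show ?thesis using m0 by simp
qed

section \<open>Splitting a vector on finite horizons and on the half line\<close>

text \<open>Surjectivity provides \<open>w\<close> such that \<open>V 0 R\<close> annihilates
  \<open>U R s (x + U s 0 w)\<close>. This vector is then in the range of \<open>P R\<close>, and
  \<open>a_priori\<close> applies with jump \<open>x\<close>.\<close>

lemma finite_horizon_splitting:
  assumes s: "0 \<le> s" "s \<le> R"
  shows "\<exists>w. P 0 w = 0 \<and> (\<forall>t\<in>{s..R}. N t (U t s (x + U s 0 w)) \<le>
    \<kappa> * exp (- l * (\<rho> t - \<rho> s)) * N s x)"
proof -
  have "- V 0 R (U R s x) \<in> kernel (P 0)"
    using s by (simp add: kernel_def blinfun.minus_right P_V)
  also have "kernel (P 0) = blinfun_apply (V 0 R o\<^sub>L U R 0) ` kernel (P 0)"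
    using transition_surj[of R] s by simp
  finally obtain w where w: "w \<in> kernel (P 0)" "V 0 R (U R 0 w) = - V 0 R (U R s x)"
    by force
  let ?v = "x + U s 0 w"
  have "V 0 R (U R s ?v) = 0"
    using w(2) s by (simp add: blinfun.add_right U_comp)
  then have "U R s ?v - P R (U R s ?v) = 0"
    using T_V[of 0 R "U R s ?v"] s by simp
  then have "P R (U R s ?v) = U R s ?v" by simp
  then show ?thesis
    using a_priori(1)[OF s _ _ refl] w(1) by (auto simp: kernel_def)
qed

text \<open>Two correctors \<open>w\<close> differ by a kernel vector whose orbit is bounded at the
  shorter horizon, so \<open>unstable_le\<close> makes the difference exponentially small. The
  correctors converge as the horizon grows.\<close>

lemma splitting:
  assumes s: "0 \<le> s"
  shows "\<exists>w. P 0 w = 0 \<and> (\<forall>t\<ge>s. N t (U t s (x + U s 0 w)) \<le>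
    \<kappa> * exp (- l * (\<rho> t - \<rho> s)) * N s x)"
proof -
  have "\<forall>n::nat. \<exists>w. P 0 w = 0 \<and> (\<forall>t\<in>{s..s + n}. N t (U t s (x + U s 0 w)) \<le>
    \<kappa> * exp (- l * (\<rho> t - \<rho> s)) * N s x)"
    using finite_horizon_splitting s by simp
  then obtain w where w: "\<And>n::nat. P 0 (w n) = 0"
    and w_le: "\<And>n t. s \<le> t \<Longrightarrow> t \<le> s + real n \<Longrightarrow> N t (U t s (x + U s 0 (w n))) \<le>
      \<kappa> * exp (- l * (\<rho> t - \<rho> s)) * N s x"
    by (metis atLeastAtMost_iff)
  \<comment> \<open>The factor \<open>2 * \<kappa>\<close> bounds the two orbits compared at
    \<open>s + n\<close>, the outer \<open>\<kappa>\<close> comes from the backward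
    estimate.\<close>
  define K where "K = \<kappa> * (2 * \<kappa> * N s x)"
  have diff: "norm (w n - w m) \<le> K * exp (- l * \<rho> (s + n))" if "n \<le> m" for n m :: nat
  proof -
    let ?R = "s + real n"
    have R: "0 \<le> ?R" "s \<le> ?R" using s by auto
    have le: "N ?R (U ?R s (x + U s 0 (w i))) \<le> \<kappa> * N s x" if "n \<le> i" for i
    proof -
      have "N ?R (U ?R s (x + U s 0 (w i))) \<le> \<kappa> * exp (- l * (\<rho> ?R - \<rho> s)) * N s x"
        using that s by (intro w_le) auto
      also have "\<dots> \<le> \<kappa> * 1 * N s x"
        using decay_le_1[OF s R(2)] \<kappa>_pos N_nonneg[OF s] by (intro mult_mono) auto
      finally show ?thesis by simp
    qed
    have w_nm: "P 0 (w n - w m) = 0"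
      using w by (simp add: blinfun.diff_right)
    have "norm (w n - w m) \<le> N 0 (U 0 0 (w n - w m))"
      by (simp add: U_id norm_le_N)
    also have "\<dots> \<le> \<kappa> * exp (- l * (\<rho> ?R - \<rho> 0)) * N ?R (U ?R 0 (w n - w m))"
      using unstable_le[OF w_nm order_refl R(1)] .
    also have "\<dots> \<le> \<kappa> * exp (- l * (\<rho> ?R - \<rho> 0)) * (2 * \<kappa> * N s x)"
    proof (rule mult_left_mono[of _ _ "\<kappa> * exp (- l * (\<rho> ?R - \<rho> 0))"])
      have "U ?R 0 (w n - w m) = U ?R s (x + U s 0 (w n)) - U ?R s (x + U s 0 (w m))"
        using s R by (simp add: blinfun.add_right blinfun.diff_right U_comp)
      then have "N ?R (U ?R 0 (w n - w m)) \<le>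
          N ?R (U ?R s (x + U s 0 (w n))) + N ?R (U ?R s (x + U s 0 (w m)))"
        using is_norm_diff[OF norm_N[OF R(1)]] by simp
      also have "\<dots> \<le> 2 * \<kappa> * N s x"
        using le[of n] le[OF that] by simp
      finally show "N ?R (U ?R 0 (w n - w m)) \<le> 2 * \<kappa> * N s x" .
    next
      show "0 \<le> \<kappa> * exp (- l * (\<rho> ?R - \<rho> 0))"
        using \<kappa>_pos by simp
    qed
    finally show ?thesis
      by (simp add: K_def \<rho>_0 mult_ac)
  qed
  have "filterlim (\<lambda>n. s + real n) at_top sequentially"
    by (rule filterlim_tendsto_add_at_top[OF tendsto_const filterlim_real_sequentially])
  from filterlim_compose[OF \<rho>_top this]
  have "filterlim (\<lambda>n. - l * \<rho> (s + real n)) at_bot sequentially"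
    using l_pos by (intro filterlim_tendsto_neg_mult_at_bot[OF tendsto_const]) auto
  then have "(\<lambda>n. exp (- l * \<rho> (s + real n))) \<longlonglongrightarrow> 0"
    by (rule filterlim_compose[OF exp_at_bot])
  then have lim: "(\<lambda>n. K * exp (- l * \<rho> (s + real n))) \<longlonglongrightarrow> 0"
    by (rule tendsto_mult_right_zero)
  have "Cauchy w"
  proof (rule CauchyI')
    fix e :: real assume "e > 0"
    then have "\<forall>\<^sub>F n in sequentially. K * exp (- l * \<rho> (s + real n)) < e"
      using lim by (rule order_tendstoD(2)[rotated])
    then obtain n0 where "\<And>n. n \<ge> n0 \<Longrightarrow> K * exp (- l * \<rho> (s + real n)) < e"
      by (auto simp: eventually_sequentially)
    then show "\<exists>M. \<forall>m\<ge>M. \<forall>n>m. dist (w m) (w n) < e"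
      using diff unfolding dist_norm by (meson le_less_trans less_imp_le)
  qed
  then obtain w' where w': "w \<longlonglongrightarrow> w'"
    using Cauchy_convergent_iff convergent_def by blast
  have "(\<lambda>n. P 0 (w n)) \<longlonglongrightarrow> P 0 w'"
    using w' by (intro tendsto_intros)
  then have "P 0 w' = 0"
    using w by (simp add: LIMSEQ_const_iff)
  moreover have "N t (U t s (x + U s 0 w')) \<le> \<kappa> * exp (- l * (\<rho> t - \<rho> s)) * N s x"
    (is "_ \<le> ?rhs") if t: "s \<le> t" for t
  proof (rule tendsto_lowerbound)
    \<comment> \<open>At fixed \<open>t\<close>, replacing \<open>w'\<close> by \<open>w n\<close>
      costs at most \<open>c t\<close> times a norm that tends to zero.\<close>
    have "(\<lambda>n. ?rhs + c t * norm (U t s (U s 0 (w' - w n)))) \<longlonglongrightarrow>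
        ?rhs + c t * norm (U t s (U s 0 (w' - w')))"
      using w' by (intro tendsto_intros)
    then show "(\<lambda>n. ?rhs + c t * norm (U t s (U s 0 (w' - w n)))) \<longlonglongrightarrow> ?rhs"
      by simp
    show "\<forall>\<^sub>F n in sequentially. N t (U t s (x + U s 0 w')) \<le>
        ?rhs + c t * norm (U t s (U s 0 (w' - w n)))"
    proof (rule eventually_sequentiallyI)
      \<comment> \<open>From this index on the horizon \<open>s + n\<close> has reached
        \<open>t\<close>.\<close>
      fix n assume n: "nat \<lceil>t - s\<rceil> \<le> n"
      have t0: "0 \<le> t" using s t by simp
      have "U t s (x + U s 0 w') = U t s (x + U s 0 (w n)) + U t s (U s 0 (w' - w n))"
        by (simp add: blinfun.add_right blinfun.diff_right)
      also have "N t \<dots> \<le> N t (U t s (x + U s 0 (w n))) + N t (U t s (U s 0 (w' - w n)))"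
        by (rule is_norm_triangle[OF norm_N[OF t0]])
      also have "\<dots> \<le> ?rhs + c t * norm (U t s (U s 0 (w' - w n)))"
        using n t by (intro add_mono w_le N_le t0) linarith+
      finally show "N t (U t s (x + U s 0 w')) \<le>
          ?rhs + c t * norm (U t s (U s 0 (w' - w n)))" .
    qed
  qed simp
  ultimately show ?thesis by blast
qed

section \<open>Stable and unstable subspaces of \<open>U\<close>\<close>

text \<open>\<open>M\<close> may depend on \<open>v\<close>, and the weight omits the starting time,
  which makes linearity and invariance under \<open>U\<close> immediate.\<close>

definition stable_space :: "real \<Rightarrow> 'a set" where
  "stable_space s = {v. \<exists>M. \<forall>t\<ge>s. N t (U t s v) \<le> M * exp (- l * \<rho> t)}"

text \<open>On a half line the dynamics do not single out a complement of the decaying vectors; the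
  unperturbed projection at time 0 fixes one.\<close>

definition unstable_space :: "real \<Rightarrow> 'a set" where
  "unstable_space s = blinfun_apply (U s 0) ` kernel (P 0)"

lemma subspace_stable:
  assumes s: "0 \<le> s"
  shows "subspace (stable_space s)"
  unfolding subspace_def
proof (intro conjI ballI allI)
  have n: "is_norm (N t)" if "s \<le> t" for t using s that by (intro norm_N) auto
  show "0 \<in> stable_space s"
    by (auto simp: stable_space_def is_norm_zero[OF n] intro!: exI[of _ 0])
  fix x y assume "x \<in> stable_space s" "y \<in> stable_space s"
  then obtain M M' where M: "\<And>t. s \<le> t \<Longrightarrow> N t (U t s x) \<le> M * exp (- l * \<rho> t)"
    "\<And>t. s \<le> t \<Longrightarrow> N t (U t s y) \<le> M' * exp (- l * \<rho> t)"
    unfolding stable_space_def by blast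
  have "N t (U t s (x + y)) \<le> (M + M') * exp (- l * \<rho> t)" if t: "s \<le> t" for t
    using is_norm_triangle[OF n[OF t], of "U t s x" "U t s y"] M[OF t]
    by (simp add: blinfun.add_right ring_distribs)
  then show "x + y \<in> stable_space s" unfolding stable_space_def by blast
next
  have n: "is_norm (N t)" if "s \<le> t" for t using s that by (intro norm_N) auto
  fix r x assume "x \<in> stable_space s"
  then obtain M where M: "\<And>t. s \<le> t \<Longrightarrow> N t (U t s x) \<le> M * exp (- l * \<rho> t)"
    unfolding stable_space_def by blast
  have "N t (U t s (r *\<^sub>R x)) \<le> (\<bar>r\<bar> * M) * exp (- l * \<rho> t)" if t: "s \<le> t" for t
    using mult_left_mono[OF M[OF t], of "\<bar>r\<bar>"]
    by (simp add: blinfun.scaleR_right is_norm_scaleR[OF n[OF t]])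
  then show "r *\<^sub>R x \<in> stable_space s" unfolding stable_space_def by blast
qed

lemma subspace_unstable: "subspace (unstable_space s)"
  unfolding unstable_space_def
  by (intro linear_subspace_image subspace_kernel bounded_linear.linear
      blinfun.bounded_linear_right)

lemma U_stable:
  assumes "0 \<le> s" "s \<le> t" "v \<in> stable_space s"
  shows "U t s v \<in> stable_space t"
proof -
  obtain M where M: "\<And>t. s \<le> t \<Longrightarrow> N t (U t s v) \<le> M * exp (- l * \<rho> t)"
    using assms unfolding stable_space_def by blast
  have "N r (U r t (U t s v)) \<le> M * exp (- l * \<rho> r)" if "t \<le> r" for r
    using M[of r] that assms by (simp add: U_comp)
  then show ?thesis unfolding stable_space_def by blast
qed

lemma U_unstable:
  assumes "0 \<le> s" "s \<le> t"
  shows "blinfun_apply (U t s) ` unstable_space s = unstable_space t"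
  using assms by (simp add: unstable_space_def image_image U_comp)

lemma unstable_backward_le:
  assumes t: "0 \<le> t" "t \<le> s" and e: "e \<in> unstable_space t"
  shows "N t e \<le> \<kappa> * exp (- l * (\<rho> s - \<rho> t)) * N s (U s t e)"
  using unstable_le[OF _ t] e t by (auto simp: unstable_space_def kernel_def U_comp)

text \<open>The backward estimate bounds \<open>v\<close> by its orbit at any later time, and that
  orbit tends to zero.\<close>

lemma stable_Int_unstable:
  assumes s: "0 \<le> s"
  shows "stable_space s \<inter> unstable_space s = {0}"
proof -
  have "v = 0" if v: "v \<in> stable_space s" "v \<in> unstable_space s" for v
  proof -
    obtain M where M: "\<And>t. s \<le> t \<Longrightarrow> N t (U t s v) \<le> M * exp (- l * \<rho> t)"
      using v(1) unfolding stable_space_def by blast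
    have "N s v \<le> \<kappa> * (M * exp (- l * \<rho> t))" if t: "s \<le> t" for t
    proof -
      have "N s v \<le> \<kappa> * exp (- l * (\<rho> t - \<rho> s)) * N t (U t s v)"
        using s t v(2) by (intro unstable_backward_le)
      also have "\<dots> \<le> \<kappa> * 1 * (M * exp (- l * \<rho> t))"
        using decay_le_1[OF s t] M[OF t] \<kappa>_pos N_nonneg[of t] s t by (intro mult_mono) auto
      finally show ?thesis by simp
    qed
    then have "\<forall>\<^sub>F t in at_top. N s v \<le> \<kappa> * (M * exp (- l * \<rho> t))"
      using eventually_ge_at_top[of s] by (rule eventually_mono[rotated])
    moreover have "((\<lambda>t. \<kappa> * (M * exp (- l * \<rho> t))) \<longlongrightarrow> 0) at_top"
    proof -
      have "filterlim (\<lambda>t. - l * \<rho> t) at_bot at_top"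
        using l_pos \<rho>_top by (intro filterlim_tendsto_neg_mult_at_bot[OF tendsto_const]) auto
      then have "((\<lambda>t. exp (- l * \<rho> t)) \<longlongrightarrow> 0) at_top"
        by (rule filterlim_compose[OF exp_at_bot])
      then show ?thesis by (intro tendsto_mult_right_zero)
    qed
    ultimately have "N s v \<le> 0"
      by (intro tendsto_lowerbound) auto
    then show "v = 0"
      using norm_le_N[OF s, of v] by (metis norm_le_zero_iff order_trans)
  qed
  moreover have "0 \<in> stable_space s" "0 \<in> unstable_space s"
    using subspace_stable[OF s] subspace_unstable by (auto intro: subspace_0)
  ultimately show ?thesis by blast
qed

text \<open>With the corrector \<open>w\<close> of \<open>splitting\<close>, the vector
  \<open>x + U s 0 w\<close> decays and the remainder is \<open>U s 0 (- w)\<close>.\<close>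

lemma stable_part:
  assumes s: "0 \<le> s"
  shows "\<exists>v\<in>stable_space s. x - v \<in> unstable_space s \<and>
    (\<forall>t\<ge>s. N t (U t s v) \<le> \<kappa> * exp (- l * (\<rho> t - \<rho> s)) * N s x)"
proof -
  obtain w where w: "P 0 w = 0"
    "\<And>t. s \<le> t \<Longrightarrow> N t (U t s (x + U s 0 w)) \<le> \<kappa> * exp (- l * (\<rho> t - \<rho> s)) * N s x"
    using splitting[OF s] by blast
  have "exp (- l * (\<rho> t - \<rho> s)) = exp (l * \<rho> s) * exp (- l * \<rho> t)" for t
    by (simp add: exp_add[symmetric] algebra_simps)
  then have "N t (U t s (x + U s 0 w)) \<le> (\<kappa> * exp (l * \<rho> s) * N s x) * exp (- l * \<rho> t)"
    if "s \<le> t" for t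
    using w(2)[OF that] by (simp only: mult_ac)
  then have "x + U s 0 w \<in> stable_space s"
    unfolding stable_space_def by blast
  moreover have "x - (x + U s 0 w) = U s 0 (- w)"
    by (simp add: blinfun.minus_right)
  then have "x - (x + U s 0 w) \<in> unstable_space s"
    unfolding unstable_space_def using w(1)
    by (intro image_eqI[of _ _ "- w"]) (simp_all add: kernel_def blinfun.minus_right)
  ultimately show ?thesis using w(2) by blast
qed

section \<open>Projections and dichotomy of \<open>U\<close>\<close>

lemma projection_exists:
  assumes s: "0 \<le> s"
  shows "\<exists>Q :: 'a \<Rightarrow>\<^sub>L 'a. \<forall>x. Q x \<in> stable_space s \<and> x - Q x \<in> unstable_space s"
proof (rule bounded_projection_exists[OF subspace_stable[OF s] subspace_unstable
      stable_Int_unstable[OF s]])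
  fix x
  obtain v where v: "v \<in> stable_space s" "x - v \<in> unstable_space s"
    "\<And>t. t \<ge> s \<Longrightarrow> N t (U t s v) \<le> \<kappa> * exp (- l * (\<rho> t - \<rho> s)) * N s x"
    using stable_part[OF s] by blast
  have "norm v \<le> N s v" by (rule norm_le_N[OF s])
  also have "\<dots> \<le> \<kappa> * N s x"
    using v(3)[of s] s by (simp add: U_id)
  also have "\<dots> \<le> \<kappa> * (c s * norm x)"
    using N_le[OF s] \<kappa>_pos by (intro mult_left_mono) auto
  finally show "\<exists>v\<in>stable_space s. x - v \<in> unstable_space s \<and> norm v \<le> \<kappa> * c s * norm x"
    using v by auto
qed

theorem rho_dichotomy_perturbed: "rho_dichotomy \<rho> N U"
proof -
  obtain Q :: "real \<Rightarrow> 'a \<Rightarrow>\<^sub>L 'a" where Q: "\<And>s x. 0 \<le> s \<Longrightarrow> Q s x \<in> stable_space s"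
    "\<And>s x. 0 \<le> s \<Longrightarrow> x - Q s x \<in> unstable_space s"
    using projection_exists by metis
  have uniq: "Q s x = v" if "0 \<le> s" "v \<in> stable_space s" "x - v \<in> unstable_space s" for s x v
  proof -
    have "Q s x - v \<in> stable_space s"
      using that Q by (intro subspace_diff[OF subspace_stable])
    moreover have "(x - v) - (x - Q s x) \<in> unstable_space s"
      by (rule subspace_diff[OF subspace_unstable that(3) Q(2)[OF that(1)]])
    ultimately have "Q s x - v \<in> stable_space s \<inter> unstable_space s" by simp
    then show ?thesis using stable_Int_unstable[OF that(1)] by simp
  qed
  have kernel_Q: "kernel (Q s) = unstable_space s" if s: "0 \<le> s" for s
  proof
    show "kernel (Q s) \<subseteq> unstable_space s"
    proof
      fix x assume "x \<in> kernel (Q s)"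
      then show "x \<in> unstable_space s"
        using Q(2)[OF s, of x] by (simp add: kernel_def)
    qed
    show "unstable_space s \<subseteq> kernel (Q s)"
      using uniq[OF s, of 0] subspace_0[OF subspace_stable[OF s]] by (auto simp: kernel_def)
  qed
  have Q_stable: "Q s v = v" if "0 \<le> s" "v \<in> stable_space s" for s v
    using that subspace_0[OF subspace_unstable] by (intro uniq) auto
  \<comment> \<open>By uniqueness, the decaying vector from \<open>stable_part\<close> is
    \<open>Q s x\<close>, so its estimate carries over.\<close>
  have forward: "N t (U t s (Q s x)) \<le> \<kappa> * exp (- l * (\<rho> t - \<rho> s)) * N s x"
    if "0 \<le> s" "s \<le> t" for s t x
    using stable_part[OF that(1), of x] uniq[OF that(1)] that by metis
  have inj: "inj_on (blinfun_apply (U t s)) (unstable_space s)" if st: "0 \<le> s" "s \<le> t" for s t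
  proof (rule inj_onI)
    fix x y assume xy: "x \<in> unstable_space s" "y \<in> unstable_space s" "U t s x = U t s y"
    then have "x - y \<in> unstable_space s" by (intro subspace_diff[OF subspace_unstable])
    from unstable_backward_le[OF st this] have "N s (x - y) \<le> 0"
      using xy(3) st is_norm_zero[OF norm_N[of t]] by (simp add: blinfun.diff_right)
    then have "norm (x - y) \<le> 0"
      using norm_le_N[OF st(1), of "x - y"] by linarith
    then show "x = y" by simp
  qed
  have bij: "bij_betw (blinfun_apply (U t s)) (kernel (Q s)) (kernel (Q t))"
    if "0 \<le> s" "s \<le> t" for s t
    using that inj U_unstable by (simp add: bij_betw_def kernel_Q)
  have comm: "U t s (Q s x) = Q t (U t s x)" if st: "0 \<le> s" "s \<le> t" for s t x
  proof (rule uniq[symmetric])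
    show "U t s (Q s x) \<in> stable_space t"
      using st Q by (intro U_stable)
    have "U t s (x - Q s x) \<in> unstable_space t"
      using U_unstable[OF st] Q(2)[OF st(1)] by blast
    then show "U t s x - U t s (Q s x) \<in> unstable_space t"
      by (simp add: blinfun.diff_right)
  qed (use st in simp)
  have backward: "N t (kernel_inverse U Q t s (x - Q s x)) \<le>
      \<kappa> * (1 + \<kappa>) * exp (- l * (\<rho> s - \<rho> t)) * N s x" if st: "0 \<le> t" "t \<le> s" for s t x
  proof -
    have s: "0 \<le> s" using st by simp
    define e where "e = kernel_inverse U Q t s (x - Q s x)"
    have im: "x - Q s x \<in> blinfun_apply (U s t) ` kernel (Q t)"
      using bij[OF st] Q(2)[OF s] kernel_Q[OF s] by (simp add: bij_betw_def)
    have e: "e \<in> unstable_space t" "U s t e = x - Q s x"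
      using inv_into_into[OF im] f_inv_into_f[OF im] kernel_Q[OF st(1)]
      by (auto simp: e_def kernel_inverse_def)
    \<comment> \<open>The extra factor \<open>1 + \<kappa>\<close> arises in passing from
      \<open>x\<close> to \<open>x - Q s x\<close>.\<close>
    have "N s (x - Q s x) \<le> N s x + N s (Q s x)"
      by (rule is_norm_diff[OF norm_N[OF s]])
    also have "N s (Q s x) \<le> \<kappa> * N s x"
      using forward[OF s order_refl] s by (simp add: U_id)
    finally have "N s (x - Q s x) \<le> (1 + \<kappa>) * N s x"
      by (simp add: algebra_simps)
    then have "\<kappa> * exp (- l * (\<rho> s - \<rho> t)) * N s (U s t e) \<le>
        \<kappa> * exp (- l * (\<rho> s - \<rho> t)) * ((1 + \<kappa>) * N s x)"
      unfolding e(2) using \<kappa>_pos by (intro mult_left_mono) auto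
    then show ?thesis
      using unstable_backward_le[OF st e(1)] by (simp add: e_def mult_ac)
  qed
  \<comment> \<open>The forward bound is weakened so that one constant serves both
    estimates.\<close>
  have forward': "N t (U t s (Q s x)) \<le>
      \<kappa> * (1 + \<kappa>) * exp (- l * (\<rho> t - \<rho> s)) * N s x" if st: "0 \<le> s" "s \<le> t" for s t x
  proof -
    have "\<kappa> * exp (- l * (\<rho> t - \<rho> s)) * N s x \<le>
        (\<kappa> * (1 + \<kappa>)) * exp (- l * (\<rho> t - \<rho> s)) * N s x"
      using \<kappa>_pos N_nonneg[OF st(1)] by (intro mult_right_mono) auto
    then show ?thesis using forward[OF st, of x] by linarith
  qed
  show ?thesis
    unfolding rho_dichotomy_def
  proof (intro exI[of _ Q] conjI allI impI)
    show "Q t o\<^sub>L Q t = Q t" if "0 \<le> t" for t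
      using that Q Q_stable by (intro blinfun_eqI) simp
    show "U t s o\<^sub>L Q s = Q t o\<^sub>L U t s" if "s \<le> t \<and> 0 \<le> s" for t s
      using that by (intro blinfun_eqI) (simp add: comm)
    show "bij_betw (U t s) (kernel (Q s)) (kernel (Q t))" if "s \<le> t \<and> 0 \<le> s" for t s
      using that bij by blast
    show "\<exists>l D. 0 < l \<and> 0 < D \<and>
      (\<forall>x t s. s \<le> t \<and> 0 \<le> s \<longrightarrow>
        N t (U t s (Q s x)) \<le> D * exp (- l * (\<rho> t - \<rho> s)) * N s x) \<and>
      (\<forall>x t s. 0 \<le> t \<and> t \<le> s \<longrightarrow>
        N t (kernel_inverse U Q t s (x - Q s x)) \<le> D * exp (- l * (\<rho> s - \<rho> t)) * N s x)"
    proof (rule exI[of _ l], rule exI[of _ "\<kappa> * (1 + \<kappa>)"], intro conjI allI impI)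
      show "0 < l" "0 < \<kappa> * (1 + \<kappa>)"
        using l_pos \<kappa>_pos by auto
    qed (use forward' backward in blast)+
  qed
qed

end

section \<open>Backward flow and smallness threshold under the original hypotheses\<close>

text \<open>Injectivity on the kernel makes the preimage linear in \<open>x\<close>, and the
  dichotomy estimate supplies the bound. This turns the backward flow into a bounded operator on the
  whole space.\<close>

lemma kernel_inverse_bounded_linear:
  fixes A Q Q' :: "'a::real_normed_vector \<Rightarrow>\<^sub>L 'a"
  assumes bij: "bij_betw (blinfun_apply A) (kernel Q) (kernel Q')"
    and Q': "\<And>x. x - Q' x \<in> kernel Q'"
    and le: "\<And>x. norm (inv_into (kernel Q) (blinfun_apply A) (x - Q' x)) \<le> M * norm x"
  shows "bounded_linear (\<lambda>x. inv_into (kernel Q) (blinfun_apply A) (x - Q' x))"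
    (is "bounded_linear ?f")
proof (rule bounded_linear_intro)
  have im: "x - Q' x \<in> blinfun_apply A ` kernel Q" for x
    using bij Q' by (simp add: bij_betw_def)
  have f: "?f x \<in> kernel Q" "A (?f x) = x - Q' x" for x
    using inv_into_into[OF im] f_inv_into_f[OF im] by auto
  have uniq: "?f x = y" if "y \<in> kernel Q" "A y = x - Q' x" for x y
    using bij f that by (metis bij_betw_imp_inj_on inj_onD)
  fix x y r
  show "?f (x + y) = ?f x + ?f y"
    by (intro uniq subspace_add[OF subspace_kernel] f(1))
      (simp add: blinfun.add_right f(2))
  show "?f (r *\<^sub>R x) = r *\<^sub>R ?f x"
    by (intro uniq subspace_scale[OF subspace_kernel] f(1))
      (simp add: blinfun.scaleR_right scaleR_diff_right f(2))
  show "norm (?f x) \<le> norm x * M"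
    using le[of x] by (simp add: mult.commute)
qed

theorem theorem2:
  fixes T :: "real \<Rightarrow> real \<Rightarrow> 'a::banach \<Rightarrow>\<^sub>L 'a"
    and N :: "real \<Rightarrow> 'a \<Rightarrow> real"
    and \<rho> \<rho>' :: "real \<Rightarrow> real"
    and C \<epsilon> :: real
  assumes "\<rho> ` {0..} \<subseteq> {0..}"
    and "strict_mono_on {0..} \<rho>"
    and "\<And>t. t \<ge> 0 \<Longrightarrow> (\<rho> has_real_derivative \<rho>' t) (at t within {0..})"
    and "continuous_on {0..} \<rho>'"
    and "\<rho> 0 = 0"
    and "filterlim \<rho> at_top at_top"
    and "evolution_family T"
    and "\<And>t. t \<ge> 0 \<Longrightarrow> is_norm (N t)"
    and "C > 0" and "\<epsilon> \<ge> 0"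
    and "\<And>x t. t \<ge> 0 \<Longrightarrow> norm x \<le> N t x"
    and "\<And>x t. t \<ge> 0 \<Longrightarrow> N t x \<le> C * exp (\<epsilon> * \<rho> t) * norm x"
    and "\<And>x. continuous_on {0..} (\<lambda>t. N t x)"
    and "rho_dichotomy \<rho> N T"
  shows "\<forall>a>0. \<exists>\<delta>0>0. \<forall>\<delta>. 0 < \<delta> \<and> \<delta> < \<delta>0 \<longrightarrow>
    (\<forall>(B :: real \<Rightarrow> 'a \<Rightarrow>\<^sub>L 'a) (U :: real \<Rightarrow> real \<Rightarrow> 'a \<Rightarrow>\<^sub>L 'a).
      (\<forall>x. continuous_on {0..} (\<lambda>t. blinfun_apply (B t) x)) \<and>
      (\<forall>t\<ge>0. norm (B t) \<le> \<delta> * exp (- (\<epsilon> + a) * \<rho> t) * \<rho>' t) \<and>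
      evolution_family U \<and> perturbed_by T B U
      \<longrightarrow> rho_dichotomy \<rho> N U)"
proof (intro allI impI)
  note T = assms(7) and N = assms(8) and norm_le_N = assms(11) and N_le = assms(12)
  fix a :: real
  assume a: "0 < a"
  obtain P where P: "\<forall>t\<ge>0. P t o\<^sub>L P t = P t"
    "\<forall>t s. t \<ge> s \<and> s \<ge> 0 \<longrightarrow> T t s o\<^sub>L P s = P t o\<^sub>L T t s"
    "\<forall>t s. t \<ge> s \<and> s \<ge> 0 \<longrightarrow> bij_betw (T t s) (kernel (P s)) (kernel (P t))"
    and "\<exists>l D. l > 0 \<and> D > 0 \<and>
      (\<forall>x t s. t \<ge> s \<and> s \<ge> 0 \<longrightarrow>
        N t (T t s (P s x)) \<le> D * exp (- l * (\<rho> t - \<rho> s)) * N s x) \<and>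
      (\<forall>x t s. 0 \<le> t \<and> t \<le> s \<longrightarrow>
        N t (kernel_inverse T P t s (x - P s x)) \<le> D * exp (- l * (\<rho> s - \<rho> t)) * N s x)"
    using assms(14) unfolding rho_dichotomy_def by (elim exE) (elim conjE, rule that)
  then obtain l D where lD: "0 < l" "0 < D"
    and bounds: "\<forall>x t s. t \<ge> s \<and> s \<ge> 0 \<longrightarrow>
        N t (T t s (P s x)) \<le> D * exp (- l * (\<rho> t - \<rho> s)) * N s x"
      "\<forall>x t s. 0 \<le> t \<and> t \<le> s \<longrightarrow>
        N t (kernel_inverse T P t s (x - P s x)) \<le> D * exp (- l * (\<rho> s - \<rho> t)) * N s x"
    by (elim exE) (elim conjE, rule that)
  have fwd: "N t (T t s (P s x)) \<le> D * exp (- l * (\<rho> t - \<rho> s)) * N s x"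
    if "0 \<le> s" "s \<le> t" for s t x
    using bounds(1) that by blast
  have bwd: "N t (kernel_inverse T P t s (x - P s x)) \<le> D * exp (- l * (\<rho> s - \<rho> t)) * N s x"
    if "0 \<le> t" "t \<le> s" for s t x
    using bounds(2) that by blast
  have bij: "bij_betw (T t s) (kernel (P s)) (kernel (P t))" if "0 \<le> s" "s \<le> t" for s t
    using P(3) that by simp
  have P_idem: "P t (P t x) = P t x" if "0 \<le> t" for t x
    using arg_cong[OF P(1)[rule_format, OF that], of "\<lambda>A. blinfun_apply A x"] by simp
  have T_P: "T t s (P s x) = P t (T t s x)" if "0 \<le> s" "s \<le> t" for s t x
    using arg_cong[OF P(2)[rule_format, of s t], of "\<lambda>A. blinfun_apply A x"] that by simp
  have in_kernel: "x - P t x \<in> kernel (P t)" if "0 \<le> t" for t x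
    using P_idem[OF that] by (simp add: kernel_def blinfun.diff_right)
  \<comment> \<open>The value is meaningful for \<open>0 \<le> t\<close> and
    \<open>t \<le> s\<close>, where bounded linearity is shown next.\<close>
  define V where "V t s = Blinfun (\<lambda>x. kernel_inverse T P t s (x - P s x))" for t s
  have V: "V t s x = kernel_inverse T P t s (x - P s x)" if ts: "0 \<le> t" "t \<le> s" for t s x
  proof -
    have s: "0 \<le> s" using ts by simp
    have "norm (kernel_inverse T P t s (x - P s x)) \<le>
        (D * exp (- l * (\<rho> s - \<rho> t)) * (C * exp (\<epsilon> * \<rho> s))) * norm x" for x
    proof -
      have "norm (kernel_inverse T P t s (x - P s x)) \<le> D * exp (- l * (\<rho> s - \<rho> t)) * N s x"
        using norm_le_N[OF ts(1)] bwd[OF ts] by (rule order_trans)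
      also have "\<dots> \<le> D * exp (- l * (\<rho> s - \<rho> t)) * (C * exp (\<epsilon> * \<rho> s) * norm x)"
        using lD N_le[OF s] by (intro mult_left_mono) auto
      finally show ?thesis by (simp only: mult.assoc)
    qed
    then have "bounded_linear (\<lambda>x. kernel_inverse T P t s (x - P s x))"
      unfolding kernel_inverse_def
      by (intro kernel_inverse_bounded_linear[OF bij[OF ts] in_kernel[OF s]])
    then show ?thesis by (simp add: V_def bounded_linear_Blinfun_apply)
  qed
  have im: "x - P s x \<in> blinfun_apply (T s t) ` kernel (P t)" if "0 \<le> t" "t \<le> s" for t s x
    using bij[OF that] in_kernel[of s x] that by (simp add: bij_betw_def)
  have P_V: "P t (V t s x) = 0" if "0 \<le> t" "t \<le> s" for t s x
    using inv_into_into[OF im[OF that]] by (simp add: V[OF that] kernel_inverse_def kernel_def)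
  have T_V: "T s t (V t s x) = x - P s x" if "0 \<le> t" "t \<le> s" for t s x
    using f_inv_into_f[OF im[OF that]] by (simp add: V[OF that] kernel_inverse_def)
  have V_T: "V t s (T s t x) = x - P t x" if "0 \<le> t" "t \<le> s" for t s x
  proof -
    have "T s t x - P s (T s t x) = T s t (x - P t x)"
      using T_P[OF that] by (simp add: blinfun.diff_right)
    then show ?thesis
      using inv_into_f_f[OF bij_betw_imp_inj_on[OF bij[OF that]] in_kernel[OF that(1)]]
      by (simp add: V[OF that] kernel_inverse_def)
  qed
  have \<rho>_mono: "\<rho> s \<le> \<rho> t" if "0 \<le> s" "s \<le> t" for s t
    using assms(2) that by (intro strict_mono_on_leD[of "{0..}" \<rho>]) auto
  show "\<exists>\<delta>0>0. \<forall>\<delta>. 0 < \<delta> \<and> \<delta> < \<delta>0 \<longrightarrow>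
    (\<forall>(B :: real \<Rightarrow> 'a \<Rightarrow>\<^sub>L 'a) (U :: real \<Rightarrow> real \<Rightarrow> 'a \<Rightarrow>\<^sub>L 'a).
      (\<forall>x. continuous_on {0..} (\<lambda>t. blinfun_apply (B t) x)) \<and>
      (\<forall>t\<ge>0. norm (B t) \<le> \<delta> * exp (- (\<epsilon> + a) * \<rho> t) * \<rho>' t) \<and>
      evolution_family U \<and> perturbed_by T B U
      \<longrightarrow> rho_dichotomy \<rho> N U)"
  \<comment> \<open>Below this threshold the constant \<open>q = D * (C * \<delta> / a)\<close> is
    less than 1.\<close>
  proof (intro exI[of _ "a / (D * C)"] conjI allI impI, goal_cases)
    case 1
    show ?case using a lD assms(9) by simp
  next
    case (2 \<delta> B U)
    then have \<delta>: "0 < \<delta>" "\<delta> < a / (D * C)"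
      and B_cont: "\<And>x. continuous_on {0..} (\<lambda>t. B t x)"
      and B_le: "\<And>t. 0 \<le> t \<Longrightarrow> norm (B t) \<le> \<delta> * exp (- (\<epsilon> + a) * \<rho> t) * \<rho>' t"
      and U: "evolution_family U" "perturbed_by T B U"
      by auto
    \<comment> \<open>The growth \<open>exp (\<epsilon> * \<rho> t)\<close> of the norm comparison
      cancels against the decay of \<open>B\<close>; what remains has the explicit bounded
      antiderivative \<open>H\<close>.\<close>
    define b where "b t = C * \<delta> * exp (- a * \<rho> t) * \<rho>' t" for t
    define H where "H t = - (C * \<delta> / a) * exp (- a * \<rho> t)" for t
    \<comment> \<open>The sign is read off from the bound on \<open>B\<close>, whose left-hand side
      is nonnegative.\<close>
    have \<rho>'_nonneg: "0 \<le> \<rho>' t" if "0 \<le> t" for t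
    proof -
      have "0 < \<delta> * exp (- (\<epsilon> + a) * \<rho> t)"
        using \<delta>(1) by simp
      moreover have "0 \<le> \<delta> * exp (- (\<epsilon> + a) * \<rho> t) * \<rho>' t"
        by (rule order_trans[OF norm_ge_zero B_le[OF that]])
      ultimately show ?thesis by (meson zero_le_mult_iff not_le)
    qed
    have \<rho>_cont: "continuous_on {0..} \<rho>"
      using assms(3) by (intro DERIV_continuous_on) auto
    have N_B_le: "N t (B t x) \<le> b t * N t x" if t: "0 \<le> t" for t x
    proof -
      have "N t (B t x) \<le> C * exp (\<epsilon> * \<rho> t) * norm (B t x)"
        by (rule N_le[OF t])
      also have "\<dots> \<le> C * exp (\<epsilon> * \<rho> t) * ((\<delta> * exp (- (\<epsilon> + a) * \<rho> t) * \<rho>' t) * N t x)"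
      proof (intro mult_left_mono)
        have "norm (B t x) \<le> norm (B t) * norm x" by (rule norm_blinfun)
        also have "\<dots> \<le> (\<delta> * exp (- (\<epsilon> + a) * \<rho> t) * \<rho>' t) * N t x"
          using B_le[OF t] norm_le_N[OF t] \<delta>(1) \<rho>'_nonneg[OF t] by (intro mult_mono) auto
        finally show "norm (B t x) \<le> (\<delta> * exp (- (\<epsilon> + a) * \<rho> t) * \<rho>' t) * N t x" .
      qed (use assms(9) in simp)
      also have "\<dots> = C * \<delta> * (exp (\<epsilon> * \<rho> t) * exp (- (\<epsilon> + a) * \<rho> t)) * \<rho>' t * N t x"
        by simp
      also have "exp (\<epsilon> * \<rho> t) * exp (- (\<epsilon> + a) * \<rho> t) = exp (- a * \<rho> t)"
        by (simp add: exp_add[symmetric] algebra_simps)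
      finally show ?thesis by (simp add: b_def)
    qed
    have H_deriv: "(H has_real_derivative b t) (at t within {0..})" if t: "0 \<le> t" for t
      unfolding H_def b_def using a
      by (auto intro!: derivative_eq_intros assms(3)[OF t])
    \<comment> \<open>\<open>- H 0\<close> is the total mass \<open>C * \<delta> / a\<close> of
      \<open>b\<close>, and \<open>H t\<close> is at most zero.\<close>
    have H_le: "D * (H t - H 0) \<le> D * (C * \<delta> / a)" if "0 \<le> t" for t
    proof (rule mult_left_mono)
      have "0 \<le> C * \<delta> / a * exp (- a * \<rho> t)"
        using assms(9) \<delta>(1) a by simp
      then show "H t - H 0 \<le> C * \<delta> / a" by (simp add: H_def assms(5))
    qed (use lD in simp)
    interpret perturbed_dichotomy T U V P B N \<rho> "\<lambda>t. C * exp (\<epsilon> * \<rho> t)" b H l D "D * (C * \<delta> / a)"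
    proof
      show "C * exp (\<epsilon> * \<rho> s) \<le> C * exp (\<epsilon> * \<rho> t)" if "0 \<le> s" "s \<le> t" for s t
        using \<rho>_mono[OF that] assms(9,10) by (simp add: mult_left_mono)
      show "continuous_on {0..} b"
        unfolding b_def by (intro continuous_intros \<rho>_cont assms(4))
      show "0 \<le> b t" if "0 \<le> t" for t
        using \<rho>'_nonneg[OF that] assms(9) \<delta>(1) by (simp add: b_def)
      show "N t (V t s x) \<le> D * exp (- l * (\<rho> s - \<rho> t)) * N s x" if "0 \<le> t" "t \<le> s" for t s x
        using bwd[OF that] by (simp add: V[OF that])
      show "D * (C * \<delta> / a) < 1"
        using \<delta>(2) a lD(2) assms(9) by (simp add: field_simps)
    qed (fact T U N norm_le_N N_le assms(5) \<rho>_mono assms(6) lD P_idem T_P P_V T_V V_T fwd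
        B_cont N_B_le H_deriv H_le)+
    show ?case by (rule rho_dichotomy_perturbed)
  qed
qed

end
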